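(* Let $F=\{f_i\}_{i=1}^N$ and $G=\{g_i\}_{i=1}^N$ be p.c.f. IFSs on complete metric spaces $(X,d_1)$ and $(Y,d_2)$ respectively, with attractors $K$ and $K'$ respectively. Suppose that both $F$ and $G$ satisfy the single intersection condition (SIC) and the angle separation condition (ASC), that $F$ and $G$ have the same topology automaton, and that all $f_i$ and $g_i$ are contractive similitudes, with contraction ratios $r_i$ and $r'_i$ respectively. (i) If $r_i=r'_i$ for every $i\in\{1,\dots,N\}$, then $(K,d_1)$ and $(K',d_2)$ are Lipschitz equivalent. (ii) If there exists $s>0$ such that $r'_i=(r_i)^s$ for every $i\in\partial\Sigma_K$, then $(K,d_1)$ and $(K',d_2)$ are quasisymmetrically equivalent.
   Context: An iterated function system (IFS) $F=\{f_i\}_{i=1}^N$ is a finite family of contractions on a complete metric space $(X,d)$. Its attractor is the unique nonempty compact $K$ with $K=\bigcup_{i=1}^N f_i(K)$. Put $\Sigma=\{1,\dots,N\}$, $\Sigma^*=\bigcup_{k\ge1}\Sigma^k$, $f_{\omega_1\cdots\omega_k}=f_{\omega_1}\circ\cdots\circ f_{\omega_k}$. The coding map $\pi_K:\Sigma^\infty\to K$ is defined by $\{\pi_K(i_1i_2\cdots)\}=\bigcap_{k\ge1}f_{i_1\cdots i_k}(K)$. The critical set is $C_F=\bigcup_{i\ne j}f_i(K)\cap f_j(K)$ and the post-critical set is $P_F=\bigcup_{\omega\in\Sigma^*}\big(f_\omega^{-1}(C_F)\cap K\big)$. $F$ is post-critically finite (p.c.f.) if $\pi_K^{-1}(P_F)$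 is finite. $\partial\Sigma_K=\{\mathbf{x}|_1:\mathbf{x}\in\pi_K^{-1}(P_F)\}\subset\Sigma$ is the set of first letters of codings of post-critical points. SIC: for all $i\ne j$, $f_i(K)\cap f_j(K)$ contains at most one point. ASC (for an IFS satisfying the SIC): there is $c>0$ such that whenever $i\neq j$ and $f_i(K)\cap f_j(K)=\{z\}$, one has $d(x,y)\ge c\max\{d(x,z),d(y,z)\}$ for all $x\in f_i(K)$, $y\in f_j(K)$. Topology automaton $M_F$ of a p.c.f. IFS $F$ with SIC, with $P=P_F$: the state set is $\{S_{uv}: u,v\in P\}\cup\{Id,Exit\}$ ($u=v$ allowed), the input alphabet is $\Sigma^2$, the initial state is $Id$, the final state is $Exit$, and the transition function $\delta$ is: - $\delta(Id,(i,j))=Id$ if $i=j$; $=S_{uv}$ if $i\ne j$, $f_i(K)\cap f_j(K)\ne\emptyset$ and $(u,v)\in P^2$ is the unique pair with $f_i(v)=f_j(u)$; $=Exit$ if $i\neq j$ and $f_i(K)\cap f_j(K)=\emptyset$. - $\delta(S_{u_1v_1},(i,j))=S_{u_2v_2}$ if $(u_2,v_2)\in P^2$ is the (unique) pair with $f_i(v_2)=v_1$ and $f_j(u_2)=u_1$; $=Exit$ otherwise (that is, if $v_1\notin f_i(K)$ or $u_1\notin f_j(K)$). $F$ and $G$ have the same topology automaton if there is a bijection $\beta:P_F\to P_G$ such that, after the relabeling $S_{uv}\mapsto S_{\beta(u)\beta(v)}$, $Id\mapsto Id$, $Exit\mapsto Exit$, the transition function of $M_F$ becomes that of $M_G$.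 Lipschitz equivalent: there is a bi-Lipschitz bijection. Quasisymmetrically equivalent: there are a homeomorphism $h:(K,d_1)\to(K',d_2)$ and an increasing homeomorphism $\eta:[0,\infty)\to[0,\infty)$ such that for all $x,y,z\in K$ and $t\ge0$, $d_1(x,y)\le t\,d_1(x,z)$ implies $d_2(h(x),h(y))\le\eta(t)\,d_2(h(x),h(z))$. *)

theory Defs
  imports "HOL-Analysis.Analysis"
begin

text \<open>A family of \<open>N\<close> maps is a function \<open>f :: nat \<Rightarrow> 'a \<Rightarrow> 'a\<close>, of which only the values at the
  letters \<open>1, \<dots>, N\<close> matter. The parameter \<open>K\<close> below always stands for its attractor.\<close>

definition ifs :: "nat \<Rightarrow> (nat \<Rightarrow> 'a \<Rightarrow> 'a::complete_space) \<Rightarrow> bool" where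
  "ifs N f \<longleftrightarrow> (\<forall>i\<in>{1..N}. \<exists>c<1. c-lipschitz_on UNIV (f i))"

definition contractive_similitude :: "real \<Rightarrow> ('a \<Rightarrow> 'a::metric_space) \<Rightarrow> bool" where
  "contractive_similitude \<rho> \<phi> \<longleftrightarrow>
     0 < \<rho> \<and> \<rho> < 1 \<and> (\<forall>x y. dist (\<phi> x) (\<phi> y) = \<rho> * dist x y)"

definition is_attractor :: "nat \<Rightarrow> (nat \<Rightarrow> 'a \<Rightarrow> 'a::metric_space) \<Rightarrow> 'a set \<Rightarrow> bool" where
  "is_attractor N f K \<longleftrightarrow> K \<noteq> {} \<and> compact K \<and> K = (\<Union>i\<in>{1..N}. f i ` K)"

primrec word_map :: "(nat \<Rightarrow> 'a \<Rightarrow> 'a) \<Rightarrow> nat list \<Rightarrow> 'a \<Rightarrow> 'a" where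
  "word_map f [] = id"
| "word_map f (i # \<omega>) = f i \<circ> word_map f \<omega>"

definition finite_words :: "nat \<Rightarrow> nat list set" where
  "finite_words N = lists {1..N} - {[]}"

definition infinite_words :: "nat \<Rightarrow> (nat \<Rightarrow> nat) set" where
  "infinite_words N = UNIV \<rightarrow> {1..N}"

text \<open>Letters of infinite words are numbered from \<open>0\<close>: the first letter of \<open>w\<close> is \<open>w 0\<close>.\<close>

definition coding_map :: "(nat \<Rightarrow> 'a \<Rightarrow> 'a) \<Rightarrow> 'a set \<Rightarrow> (nat \<Rightarrow> nat) \<Rightarrow> 'a" where
  "coding_map f K w = (THE x. {x} = (\<Inter>k\<in>{1..}. word_map f (map w [0..<k]) ` K))"

definition critical_set :: "nat \<Rightarrow> (nat \<Rightarrow> 'a \<Rightarrow> 'a) \<Rightarrow> 'a set \<Rightarrow> 'a set" where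
  "critical_set N f K = (\<Union>i\<in>{1..N}. \<Union>j\<in>{1..N} - {i}. f i ` K \<inter> f j ` K)"

definition post_critical_set :: "nat \<Rightarrow> (nat \<Rightarrow> 'a \<Rightarrow> 'a) \<Rightarrow> 'a set \<Rightarrow> 'a set" where
  "post_critical_set N f K =
     (\<Union>\<omega>\<in>finite_words N. (word_map f \<omega> -` critical_set N f K) \<inter> K)"

definition post_critical_codings :: "nat \<Rightarrow> (nat \<Rightarrow> 'a \<Rightarrow> 'a) \<Rightarrow> 'a set \<Rightarrow> (nat \<Rightarrow> nat) set" where
  "post_critical_codings N f K =
     {w \<in> infinite_words N. coding_map f K w \<in> post_critical_set N f K}"

definition pcf :: "nat \<Rightarrow> (nat \<Rightarrow> 'a \<Rightarrow> 'a) \<Rightarrow> 'a set \<Rightarrow> bool" where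
  "pcf N f K \<longleftrightarrow> finite (post_critical_codings N f K)"

definition boundary_letters :: "nat \<Rightarrow> (nat \<Rightarrow> 'a \<Rightarrow> 'a) \<Rightarrow> 'a set \<Rightarrow> nat set" where
  "boundary_letters N f K = (\<lambda>w. w 0) ` post_critical_codings N f K"

definition SIC :: "nat \<Rightarrow> (nat \<Rightarrow> 'a \<Rightarrow> 'a) \<Rightarrow> 'a set \<Rightarrow> bool" where
  "SIC N f K \<longleftrightarrow>
     (\<forall>i\<in>{1..N}. \<forall>j\<in>{1..N}. i \<noteq> j \<longrightarrow>
        (\<forall>x y. x \<in> f i ` K \<inter> f j ` K \<longrightarrow> y \<in> f i ` K \<inter> f j ` K \<longrightarrow> x = y))"

definition ASC :: "nat \<Rightarrow> (nat \<Rightarrow> 'a \<Rightarrow> 'a::metric_space) \<Rightarrow> 'a set \<Rightarrow> bool" where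
  "ASC N f K \<longleftrightarrow>
     (\<exists>c>0. \<forall>i\<in>{1..N}. \<forall>j\<in>{1..N}. \<forall>z. i \<noteq> j \<and> f i ` K \<inter> f j ` K = {z} \<longrightarrow>
        (\<forall>x\<in>f i ` K. \<forall>y\<in>f j ` K. dist x y \<ge> c * max (dist x z) (dist y z)))"


datatype 'p state = Ident | Exit | S 'p 'p

record ('q, 'l) automaton =
  states :: "'q set"
  alphabet :: "'l set"
  initial :: 'q
  final :: 'q
  trans_fun :: "'q \<Rightarrow> 'l \<Rightarrow> 'q"

text \<open>No transition leaves the final state \<open>Exit\<close>; to keep the transition function total, it is
  made absorbing. This does not affect the comparison of two automata.\<close>

fun transition ::
  "nat \<Rightarrow> (nat \<Rightarrow> 'a \<Rightarrow> 'a) \<Rightarrow> 'a set \<Rightarrow> 'a state \<Rightarrow> nat \<times> nat \<Rightarrow> 'a state" where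
  "transition N f K Ident (i, j) =
     (if i = j then Ident
      else if f i ` K \<inter> f j ` K \<noteq> {} then
        (THE q. \<exists>u\<in>post_critical_set N f K. \<exists>v\<in>post_critical_set N f K.
           q = S u v \<and> f i v = f j u)
      else Exit)"
| "transition N f K (S u1 v1) (i, j) =
     (if \<exists>u\<in>post_critical_set N f K. \<exists>v\<in>post_critical_set N f K. f i v = v1 \<and> f j u = u1 then
        (THE q. \<exists>u\<in>post_critical_set N f K. \<exists>v\<in>post_critical_set N f K.
           q = S u v \<and> f i v = v1 \<and> f j u = u1)
      else Exit)"
| "transition N f K Exit (i, j) = Exit"

definition topology_automaton ::
  "nat \<Rightarrow> (nat \<Rightarrow> 'a \<Rightarrow> 'a) \<Rightarrow> 'a set \<Rightarrow> ('a state, nat \<times> nat) automaton" where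
  "topology_automaton N f K =
     \<lparr> states = {Ident, Exit} \<union>
         {S u v | u v. u \<in> post_critical_set N f K \<and> v \<in> post_critical_set N f K},
       alphabet = {1..N} \<times> {1..N},
       initial = Ident,
       final = Exit,
       trans_fun = transition N f K \<rparr>"

text \<open>The relabelling induced by \<open>\<beta>\<close> is the functorial action \<^term>\<open>map_state\<close> of the state type:
  it sends \<open>S u v\<close> to \<open>S (\<beta> u) (\<beta> v)\<close> and fixes \<open>Ident\<close> and \<open>Exit\<close>.\<close>

definition same_topology_automaton ::
  "nat \<Rightarrow> (nat \<Rightarrow> 'a \<Rightarrow> 'a) \<Rightarrow> 'a set \<Rightarrow> (nat \<Rightarrow> 'b \<Rightarrow> 'b) \<Rightarrow> 'b set \<Rightarrow> bool" where
  "same_topology_automaton N f K g K' \<longleftrightarrow>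
     (\<exists>\<beta>. bij_betw \<beta> (post_critical_set N f K) (post_critical_set N g K') \<and>
        (\<forall>q\<in>states (topology_automaton N f K). \<forall>a\<in>alphabet (topology_automaton N f K).
           trans_fun (topology_automaton N g K') (map_state \<beta> q) a =
           map_state \<beta> (trans_fun (topology_automaton N f K) q a)))"


definition lipschitz_equivalent :: "'a::metric_space set \<Rightarrow> 'b::metric_space set \<Rightarrow> bool" where
  "lipschitz_equivalent A B \<longleftrightarrow>
     (\<exists>h. bij_betw h A B \<and>
        (\<exists>C>0. \<forall>x\<in>A. \<forall>y\<in>A. dist x y / C \<le> dist (h x) (h y) \<and> dist (h x) (h y) \<le> C * dist x y))"

definition quasisymmetrically_equivalent ::
  "'a::metric_space set \<Rightarrow> 'b::metric_space set \<Rightarrow> bool" where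
  "quasisymmetrically_equivalent A B \<longleftrightarrow>
     (\<exists>h h' \<eta> \<eta>'. homeomorphism A B h h' \<and>
        homeomorphism {0::real..} {0::real..} \<eta> \<eta>' \<and> strict_mono_on {0..} \<eta> \<and>
        (\<forall>x\<in>A. \<forall>y\<in>A. \<forall>z\<in>A. \<forall>t\<ge>0. dist x y \<le> t * dist x z \<longrightarrow>
           dist (h x) (h y) \<le> \<eta> t * dist (h x) (h z)))"

end

theory Submission
  imports Defs
begin

text \<open>Having the same topology automaton forces two codings to name the same point of \<open>K\<close> exactly when
  they name the same point of \<open>K'\<close>, which gives a bijection \<open>h : K \<rightarrow> K'\<close> with \<open>h \<circ> f\<^sub>i = g\<^sub>i \<circ> h\<close>.
  The distance of a point \<open>p\<close> to a post-critical point \<open>v\<close> is, up to constants, the contraction ratio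
  of the smallest cylinder containing both, and the word of that cylinder consists of boundary
  letters; hence \<open>d(h p, h v)\<close> is comparable to \<open>d(p, v)\<^sup>s\<close>. By the angle separation condition the same
  holds for two points of \<open>K\<close> in different pieces of level one. So for all \<open>p \<noteq> q\<close>, if \<open>\<omega>\<close> is the word
  of a smallest common cylinder, \<open>d(p, q) = r\<^sub>\<omega> e\<close> and \<open>d(h p, h q)\<close> is comparable to \<open>r'\<^sub>\<omega> e\<^sup>s\<close>, which is
  (i) when \<open>s = 1\<close>. For (ii) choose \<open>a \<le> s \<le> b\<close> with \<open>r\<^sub>i\<^sup>b \<le> r'\<^sub>i \<le> r\<^sub>i\<^sup>a\<close>: comparing the cylinders of
  \<open>x, y\<close> and of \<open>x, z\<close> yields the control function \<open>\<eta>(t) = C (t\<^sup>a + t\<^sup>b)\<close>.\<close>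

section \<open>The coding map of a self-similar set\<close>

lemma word_map_append: "word_map f (\<omega> @ \<tau>) = word_map f \<omega> \<circ> word_map f \<tau>"
  by (induction \<omega>) (auto simp: fun_eq_iff)

lemma map_upt_add: "map w [0..<m + n] = map w [0..<m] @ map (\<lambda>k. w (m + k)) [0..<n]"
  by (induction n) auto

lemma infinite_words_shift: "w \<in> infinite_words N \<Longrightarrow> (\<lambda>k. w (m + k)) \<in> infinite_words N"
  by (auto simp: infinite_words_def)

lemma infinite_words_case_nat:
  "i \<in> {1..N} \<Longrightarrow> w \<in> infinite_words N \<Longrightarrow> case_nat i w \<in> infinite_words N"
  unfolding infinite_words_def Pi_iff by (simp split: nat.split)

lemma infinite_words_nth: "w \<in> infinite_words N \<Longrightarrow> w k \<in> {1..N}"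
  by (auto simp: infinite_words_def)

lemma map_upt_in_lists: "w \<in> infinite_words N \<Longrightarrow> map w [m..<n] \<in> lists {1..N}"
  by (auto simp: infinite_words_def Pi_def)

abbreviation word_ratio :: "(nat \<Rightarrow> real) \<Rightarrow> nat list \<Rightarrow> real" where
  "word_ratio r \<omega> \<equiv> prod_list (map r \<omega>)"

locale similitude_ifs =
  fixes N :: nat and f :: "nat \<Rightarrow> 'a \<Rightarrow> 'a::metric_space" and K :: "'a set" and r :: "nat \<Rightarrow> real"
  assumes attractor: "is_attractor N f K"
    and similitude: "i \<in> {1..N} \<Longrightarrow> contractive_similitude (r i) (f i)"
begin

abbreviation \<pi> where "\<pi> \<equiv> coding_map f K"
abbreviation P where "P \<equiv> post_critical_set N f K"

lemma compact_K: "compact K" and K_nonempty: "K \<noteq> {}" and K_eq: "K = (\<Union>i\<in>{1..N}. f i ` K)"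
  using attractor by (auto simp: is_attractor_def)

lemma letters_nonempty: "{1..N} \<noteq> {}"
  using K_eq K_nonempty by auto

lemma map_in_K: "i \<in> {1..N} \<Longrightarrow> p \<in> K \<Longrightarrow> f i p \<in> K"
  using K_eq by blast

lemma in_K_cases:
  assumes "p \<in> K"
  obtains i q where "i \<in> {1..N}" "q \<in> K" "p = f i q"
  using K_eq assms by blast

lemma ratio_pos: "i \<in> {1..N} \<Longrightarrow> 0 < r i"
  and ratio_less_1: "i \<in> {1..N} \<Longrightarrow> r i < 1"
  and dist_map: "i \<in> {1..N} \<Longrightarrow> dist (f i p) (f i q) = r i * dist p q"
  using similitude by (auto simp: contractive_similitude_def)

lemma map_eq_iff: "i \<in> {1..N} \<Longrightarrow> f i p = f i q \<longleftrightarrow> p = q"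
  using dist_map[of i p q] ratio_pos[of i] by auto

lemma word_ratio_pos: "\<omega> \<in> lists {1..N} \<Longrightarrow> 0 < word_ratio r \<omega>"
  by (induction \<omega> rule: lists.induct) (auto simp: ratio_pos)

lemma dist_word_map:
  "\<omega> \<in> lists {1..N} \<Longrightarrow> dist (word_map f \<omega> p) (word_map f \<omega> q) = word_ratio r \<omega> * dist p q"
  by (induction \<omega> rule: lists.induct) (auto simp: dist_map)

lemma word_map_eq_iff: "\<omega> \<in> lists {1..N} \<Longrightarrow> word_map f \<omega> p = word_map f \<omega> q \<longleftrightarrow> p = q"
  using dist_word_map[of \<omega> p q] word_ratio_pos[of \<omega>] by auto

lemma word_map_in_K: "\<omega> \<in> lists {1..N} \<Longrightarrow> p \<in> K \<Longrightarrow> word_map f \<omega> p \<in> K"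
  by (induction \<omega> rule: lists.induct) (auto intro: map_in_K[simplified])

lemma word_map_image_subset: "\<omega> \<in> lists {1..N} \<Longrightarrow> word_map f \<omega> ` K \<subseteq> K"
  using word_map_in_K by blast

lemma compact_word_map_image: "\<omega> \<in> lists {1..N} \<Longrightarrow> compact (word_map f \<omega> ` K)"
proof (rule compact_continuous_image[OF _ compact_K])
  assume \<omega>: "\<omega> \<in> lists {1..N}"
  have "(word_ratio r \<omega>)-lipschitz_on K (word_map f \<omega>)"
    using word_ratio_pos[OF \<omega>]
    by (intro lipschitz_onI) (simp_all only: dist_word_map[OF \<omega>] less_imp_le order_refl)
  then show "continuous_on K (word_map f \<omega>)"
    by (rule lipschitz_on_continuous_on)
qed

lemma compact_map_image: "i \<in> {1..N} \<Longrightarrow> compact (f i ` K)"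
  using compact_word_map_image[of "[i]"] by simp

lemma diameter_bound: obtains D where "D > 0" "\<And>p q. p \<in> K \<Longrightarrow> q \<in> K \<Longrightarrow> dist p q \<le> D"
proof -
  have "bounded K" by (rule compact_imp_bounded[OF compact_K])
  then obtain e x where e: "\<And>p. p \<in> K \<Longrightarrow> dist x p \<le> e"
    by (auto simp: bounded_def)
  have "dist p q \<le> 2 * \<bar>e\<bar> + 1" if "p \<in> K" "q \<in> K" for p q
    using e[OF that(1)] e[OF that(2)] dist_triangle3[of p q x] by linarith
  then show thesis
    by (intro that[of "2 * \<bar>e\<bar> + 1"]) simp_all
qed

lemma max_ratio: obtains \<rho> where "0 < \<rho>" "\<rho> < 1" "\<And>i. i \<in> {1..N} \<Longrightarrow> r i \<le> \<rho>"
proof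
  have "Max (r ` {1..N}) \<in> r ` {1..N}"
    using letters_nonempty by (intro Max_in) auto
  then obtain i where "i \<in> {1..N}" "Max (r ` {1..N}) = r i"
    by (rule imageE)
  then show "0 < Max (r ` {1..N})" "Max (r ` {1..N}) < 1"
    by (simp_all only: ratio_pos ratio_less_1)
qed simp

lemma min_ratio: obtains \<rho> where "0 < \<rho>" "\<rho> < 1" "\<And>i. i \<in> {1..N} \<Longrightarrow> \<rho> \<le> r i"
proof
  have "Min (r ` {1..N}) \<in> r ` {1..N}"
    using letters_nonempty by (intro Min_in) auto
  then obtain i where "i \<in> {1..N}" "Min (r ` {1..N}) = r i"
    by (rule imageE)
  then show "0 < Min (r ` {1..N})" "Min (r ` {1..N}) < 1"
    by (simp_all only: ratio_pos ratio_less_1)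
qed simp

section \<open>Codings of points by nested cylinders\<close>

lemma word_ratio_tendsto_0:
  assumes w: "w \<in> infinite_words N"
  shows "(\<lambda>n. word_ratio r (map w [0..<n])) \<longlonglongrightarrow> 0"
proof -
  obtain \<rho> where \<rho>: "0 < \<rho>" "\<rho> < 1" "\<And>i. i \<in> {1..N} \<Longrightarrow> r i \<le> \<rho>"
    using max_ratio by blast
  have le: "word_ratio r (map w [0..<n]) \<le> \<rho> ^ n" for n
  proof (induction n)
    case (Suc n)
    have "word_ratio r (map w [0..<n]) * r (w n) \<le> \<rho> ^ n * \<rho>"
    proof (rule mult_mono[OF Suc.IH])
      show "r (w n) \<le> \<rho>" by (rule \<rho>(3)[OF infinite_words_nth[OF w]])
      show "0 \<le> r (w n)" by (rule less_imp_le[OF ratio_pos[OF infinite_words_nth[OF w]]])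
      show "0 \<le> \<rho> ^ n" using \<rho>(1) by simp
    qed
    then show ?case
      by (simp add: mult.commute)
  qed simp
  show ?thesis
  proof (rule tendsto_sandwich)
    show "\<forall>\<^sub>F n in sequentially. 0 \<le> word_ratio r (map w [0..<n])"
      by (rule always_eventually) (rule allI less_imp_le word_ratio_pos map_upt_in_lists w)+
    show "\<forall>\<^sub>F n in sequentially. word_ratio r (map w [0..<n]) \<le> \<rho> ^ n"
      by (rule always_eventually) (rule allI le)+
    show "(\<lambda>n. \<rho> ^ n) \<longlonglongrightarrow> 0"
      using \<rho>(1,2) by (intro LIMSEQ_realpow_zero) simp_all
  qed (rule tendsto_const)
qed

text \<open>Both points lie in cylinders of diameter at most \<open>word_ratio\<close> times a bound
  for the diameter of \<open>K\<close>, and these diameters tend to 0.\<close>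

lemma coding_unique:
  assumes w: "w \<in> infinite_words N"
    and p: "\<And>n. p \<in> word_map f (map w [0..<n]) ` K"
    and q: "\<And>n. q \<in> word_map f (map w [0..<n]) ` K"
  shows "p = q"
proof -
  obtain D where D: "D > 0" "\<And>p q. p \<in> K \<Longrightarrow> q \<in> K \<Longrightarrow> dist p q \<le> D"
    using diameter_bound by blast
  have "dist p q \<le> word_ratio r (map w [0..<n]) * D" for n
  proof -
    obtain p' q' where "p' \<in> K" "q' \<in> K" "p = word_map f (map w [0..<n]) p'"
      "q = word_map f (map w [0..<n]) q'"
      using p q by blast
    then show ?thesis
      using D(2)[of p' q'] word_ratio_pos[OF map_upt_in_lists[OF w, of 0 n]]
      by (simp only: dist_word_map map_upt_in_lists[OF w] mult_left_mono less_imp_le)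
  qed
  moreover have "(\<lambda>n. word_ratio r (map w [0..<n]) * D) \<longlonglongrightarrow> 0"
    by (rule tendsto_mult_left_zero[OF word_ratio_tendsto_0[OF w]])
  ultimately have "dist p q \<le> 0"
    by (intro LIMSEQ_le_const) auto
  then show ?thesis by simp
qed

lemma cylinders_decreasing:
  assumes w: "w \<in> infinite_words N"
  shows "word_map f (map w [0..<m + n]) ` K \<subseteq> word_map f (map w [0..<m]) ` K"
  unfolding map_upt_add word_map_append image_comp[symmetric]
  by (intro image_mono word_map_image_subset map_upt_in_lists infinite_words_shift w)

text \<open>Cylinders are compact and decreasing: finitely many of them all contain a deeper one,
  which is nonempty. The finite intersection property inside \<open>K\<close> gives a common
  point.\<close>

lemma coding_exists:
  assumes w: "w \<in> infinite_words N"
  shows "\<exists>p. \<forall>n. p \<in> word_map f (map w [0..<n]) ` K"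
proof -
  have "K \<inter> (\<Inter>n. word_map f (map w [0..<n]) ` K) \<noteq> {}"
  proof (rule compact_imp_fip_image[OF compact_K])
    fix I :: "nat set" assume "finite I"
    then obtain m where "\<forall>n\<in>I. n \<le> m"
      using finite_nat_set_iff_bounded_le by auto
    then have "word_map f (map w [0..<m]) ` K \<subseteq> (\<Inter>n\<in>I. word_map f (map w [0..<n]) ` K)"
      using cylinders_decreasing[OF w] by (fastforce dest!: le_Suc_ex)
    moreover have "word_map f (map w [0..<m]) ` K \<subseteq> K"
      by (intro word_map_image_subset map_upt_in_lists w)
    ultimately show "K \<inter> (\<Inter>n\<in>I. word_map f (map w [0..<n]) ` K) \<noteq> {}"
      using K_nonempty by blast
  qed (intro compact_imp_closed compact_word_map_image map_upt_in_lists w)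
  then show ?thesis by blast
qed

text \<open>This removes the \<open>THE\<close> from \<open>coding_map\<close>: codings are handled
  from here on through membership in all cylinders.\<close>

lemma coding_map_eqI:
  assumes w: "w \<in> infinite_words N" and p: "\<And>n. p \<in> word_map f (map w [0..<n]) ` K"
  shows "\<pi> w = p"
proof -
  \<comment> \<open>The definition intersects over \<open>k \<ge> 1\<close> only. Level
    \<open>n\<close> contains level \<open>n + 1\<close>, so level 0, which
    \<open>coding_unique\<close> asks for, follows as well.\<close>
  have "q = p" if q: "\<forall>k\<ge>1. q \<in> word_map f (map w [0..<k]) ` K" for q
  proof (rule coding_unique[OF w _ p])
    fix n
    have "q \<in> word_map f (map w [0..<n + 1]) ` K"
      using q by (simp only: le_add2)
    then show "q \<in> word_map f (map w [0..<n]) ` K"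
      using cylinders_decreasing[OF w, of n 1] by (rule subsetD[rotated])
  qed
  then have sing: "(\<Inter>k\<in>{1..}. word_map f (map w [0..<k]) ` K) = {p}"
    by (intro set_eqI iffI) (simp_all add: p)
  show ?thesis
    unfolding coding_map_def sing by simp
qed

lemma coding_map_in_cylinder:
  assumes w: "w \<in> infinite_words N"
  shows "\<pi> w \<in> word_map f (map w [0..<n]) ` K"
proof -
  obtain p where p: "\<forall>n. p \<in> word_map f (map w [0..<n]) ` K"
    using coding_exists[OF w] by (rule exE)
  show ?thesis
    unfolding coding_map_eqI[OF w spec[OF p]] using p by (rule spec)
qed

lemma coding_map_in_K: "w \<in> infinite_words N \<Longrightarrow> \<pi> w \<in> K"
  using coding_map_in_cylinder[of w 0] by auto

lemma coding_map_shift: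
  assumes w: "w \<in> infinite_words N"
  shows "\<pi> w = word_map f (map w [0..<n]) (\<pi> (\<lambda>k. w (n + k)))"
proof -
  let ?p = "word_map f (map w [0..<n]) (\<pi> (\<lambda>k. w (n + k)))"
  have "?p \<in> word_map f (map w [0..<n + m]) ` K" for m
    unfolding map_upt_add word_map_append image_comp[symmetric]
    by (intro imageI coding_map_in_cylinder infinite_words_shift w)
  moreover have "word_map f (map w [0..<n + m]) ` K \<subseteq> word_map f (map w [0..<m]) ` K" for m
    using cylinders_decreasing[OF w, of m n] by (simp add: add.commute)
  ultimately show ?thesis
    by (intro coding_map_eqI w) blast
qed

lemma coding_map_Suc:
  assumes w: "w \<in> infinite_words N"
  shows "\<pi> w = f (w 0) (\<pi> (\<lambda>k. w (Suc k)))"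
  using coding_map_shift[OF w, of 1] by simp

lemma coding_map_case_nat:
  "i \<in> {1..N} \<Longrightarrow> w \<in> infinite_words N \<Longrightarrow> \<pi> (case_nat i w) = f i (\<pi> w)"
  by (subst coding_map_Suc) (auto simp: infinite_words_case_nat)

text \<open>Choose for every point of \<open>K\<close> a letter \<open>L p\<close> and a preimage
  \<open>T p\<close> in \<open>K\<close>; the letters met along the orbit of \<open>p\<close> under
  \<open>T\<close> form a coding.\<close>

lemma coding_map_surj:
  assumes "p \<in> K"
  obtains w where "w \<in> infinite_words N" "\<pi> w = p"
proof -
  have "\<exists>i q. i \<in> {1..N} \<and> q \<in> K \<and> p = f i q" if "p \<in> K" for p
    using that in_K_cases by metis
  then obtain L T where LT: "\<And>p. p \<in> K \<Longrightarrow> L p \<in> {1..N} \<and> T p \<in> K \<and> p = f (L p) (T p)"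
    by metis
  define w where "w n = L ((T ^^ n) p)" for n
  have TK: "(T ^^ n) p \<in> K" for n
    using assms LT by (induction n) auto
  have "word_map f (map w [0..<n]) ((T ^^ n) p) = p" for n
  proof (induction n)
    case (Suc n)
    have "f (w n) (T ((T ^^ n) p)) = (T ^^ n) p"
      using LT[OF TK[of n]] by (simp add: w_def)
    with Suc show ?case by (simp add: word_map_append)
  qed auto
  then have "p \<in> word_map f (map w [0..<n]) ` K" for n
    using TK by (metis imageI)
  moreover have "w \<in> infinite_words N"
    using LT[OF TK] by (auto simp: infinite_words_def w_def)
  ultimately show thesis
    using coding_map_eqI that by blast
qed

text \<open>Pull \<open>q\<close> back by the deepest cylinder along \<open>w\<close> that still
  contains it.\<close>

lemma first_separation:
  assumes w: "w \<in> infinite_words N" and q: "q \<in> K" "q \<noteq> \<pi> w"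
  obtains n q' where "q' \<in> K" "q' \<notin> f (w n) ` K" "q = word_map f (map w [0..<n]) q'"
proof -
  define n where "n = (LEAST n. q \<notin> word_map f (map w [0..<n]) ` K)"
  have "\<exists>n. q \<notin> word_map f (map w [0..<n]) ` K"
    using coding_map_eqI[OF w, of q] q by metis
  then have n: "q \<notin> word_map f (map w [0..<n]) ` K"
    unfolding n_def by (rule LeastI_ex)
  \<comment> \<open>The cylinder of level 0 is \<open>K\<close>, which contains \<open>q\<close>, so
    the first level that misses \<open>q\<close> is a successor.\<close>
  then obtain m where m: "n = Suc m"
    using q by (cases n) auto
  have "q \<in> word_map f (map w [0..<m]) ` K"
    using not_less_Least[of m "\<lambda>n. q \<notin> word_map f (map w [0..<n]) ` K"] m n_def by simp
  then obtain q' where q': "q' \<in> K" "q = word_map f (map w [0..<m]) q'"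
    by blast
  moreover have "q' \<notin> f (w m) ` K"
    using n q' by (auto simp: m word_map_append)
  ultimately show thesis
    using that by blast
qed

section \<open>Post-critical points\<close>

lemma post_critical_in_K: "v \<in> P \<Longrightarrow> v \<in> K"
  by (auto simp: post_critical_set_def)

text \<open>The one-letter word \<open>[i]\<close> is a witness: it sends \<open>v\<close> to a
  common point of two pieces.\<close>

lemma post_critical_of_critical:
  assumes "i \<in> {1..N}" "j \<in> {1..N}" "i \<noteq> j" "u \<in> K" "v \<in> K" "f i v = f j u"
  shows "v \<in> P"
proof -
  have "f i v \<in> f i ` K \<inter> f j ` K"
    using assms by blast
  then have "word_map f [i] v \<in> critical_set N f K"
    using assms(1-3) unfolding critical_set_def word_map.simps comp_id by blast
  moreover have "[i] \<in> finite_words N"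
    using assms by (auto simp: finite_words_def)
  ultimately show ?thesis
    using assms unfolding post_critical_set_def by blast
qed

text \<open>A word that sends \<open>f i v\<close> into the critical set, extended by
  \<open>i\<close> on the right, sends \<open>v\<close> there.\<close>

lemma post_critical_preimage:
  assumes "i \<in> {1..N}" "v \<in> K" "f i v \<in> P"
  shows "v \<in> P"
proof -
  obtain \<omega> where "\<omega> \<in> finite_words N" "word_map f \<omega> (f i v) \<in> critical_set N f K"
    using assms by (auto simp: post_critical_set_def)
  then have "\<omega> @ [i] \<in> finite_words N" "word_map f (\<omega> @ [i]) v \<in> critical_set N f K"
    using assms by (auto simp: finite_words_def word_map_append)
  then show ?thesis
    using assms unfolding post_critical_set_def by blast
qed

text \<open>Any coding of \<open>v\<close>, prefixed by \<open>i\<close>, is a coding of the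
  post-critical point \<open>f i v\<close>.\<close>

lemma boundary_letterI:
  assumes "i \<in> {1..N}" "v \<in> K" "f i v \<in> P"
  shows "i \<in> boundary_letters N f K"
proof -
  obtain w where w: "w \<in> infinite_words N" "\<pi> w = v"
    using coding_map_surj assms by blast
  have "case_nat i w \<in> post_critical_codings N f K"
    using assms w
    by (simp add: post_critical_codings_def infinite_words_case_nat coding_map_case_nat)
  then show ?thesis
    unfolding boundary_letters_def by (rule rev_image_eqI) simp
qed

lemma finite_post_critical_set:
  assumes "pcf N f K"
  shows "finite P"
proof (rule finite_subset)
  show "P \<subseteq> \<pi> ` post_critical_codings N f K"
  proof
    fix v assume v: "v \<in> P"
    then obtain w where w: "w \<in> infinite_words N" "\<pi> w = v"
      using coding_map_surj post_critical_in_K by blast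
    with v show "v \<in> \<pi> ` post_critical_codings N f K"
      by (intro image_eqI[of _ _ w]) (simp_all add: post_critical_codings_def)
  qed
  show "finite (\<pi> ` post_critical_codings N f K)"
    using assms by (simp add: pcf_def)
qed

end

section \<open>The conjugacy given by the topology automaton\<close>

locale pcf_ifs = similitude_ifs +
  assumes pcf: "pcf N f K" and SIC: "SIC N f K" and ASC: "ASC N f K"
begin

text \<open>By the SIC the pair \<open>(u, v)\<close> is unique, so the \<open>THE\<close> in the
  definition is meaningful. In this form the automaton becomes a test for
  \<open>f i v = f j u\<close>, with the \<open>Exit\<close> case included.\<close>

lemma transition_Ident_eq_S_iff:
  assumes ij: "i \<in> {1..N}" "j \<in> {1..N}" "i \<noteq> j"
  shows "transition N f K Ident (i, j) = S u v \<longleftrightarrow> u \<in> P \<and> v \<in> P \<and> f i v = f j u"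
proof (cases "f i ` K \<inter> f j ` K = {}")
  case True
  then have "\<not> (u \<in> P \<and> v \<in> P \<and> f i v = f j u)"
    using post_critical_in_K by blast
  with True ij show ?thesis by simp
next
  case False
  then obtain u0 v0 where uv0: "u0 \<in> K" "v0 \<in> K" "f i v0 = f j u0"
    by auto
  then have P0: "u0 \<in> P" "v0 \<in> P"
    using ij post_critical_of_critical[of i j u0 v0] post_critical_of_critical[of j i v0 u0] by auto
  have unique: "u = u0 \<and> v = v0" if "u \<in> P" "v \<in> P" "f i v = f j u" for u v
  proof -
    have "f i v \<in> f i ` K \<inter> f j ` K" "f i v0 \<in> f i ` K \<inter> f j ` K"
      using that uv0 post_critical_in_K by (metis IntI imageI)+
    then have "f i v = f i v0"
      using SIC[unfolded SIC_def, rule_format, OF ij] by blast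
    then show ?thesis
      using that uv0 map_eq_iff[OF ij(1), of v v0] map_eq_iff[OF ij(2), of u u0] by simp
  qed
  have "(THE q. \<exists>u\<in>P. \<exists>v\<in>P. q = S u v \<and> f i v = f j u) = S u0 v0"
  proof (rule the_equality)
    show "\<exists>u\<in>P. \<exists>v\<in>P. S u0 v0 = S u v \<and> f i v = f j u"
      using P0 uv0 by (intro bexI[of _ u0] bexI[of _ v0]) simp_all
  next
    fix q assume "\<exists>u\<in>P. \<exists>v\<in>P. q = S u v \<and> f i v = f j u"
    then obtain u v where "u \<in> P" "v \<in> P" "q = S u v" "f i v = f j u"
      by (elim bexE conjE)
    then show "q = S u0 v0"
      using unique[of u v] by simp
  qed
  then have "transition N f K Ident (i, j) = S u0 v0"
    using False ij by simp
  moreover have "S u0 v0 = S u v \<longleftrightarrow> u \<in> P \<and> v \<in> P \<and> f i v = f j u"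
    unfolding state.inject using P0 uv0(3) unique[of u v] by metis
  ultimately show ?thesis
    by (simp only:)
qed

text \<open>Here the pair is unique because \<open>f i\<close> and \<open>f j\<close> are
  injective.\<close>

lemma transition_S_eq_S_iff:
  assumes ij: "i \<in> {1..N}" "j \<in> {1..N}"
  shows "transition N f K (S u1 v1) (i, j) = S u v \<longleftrightarrow>
    u \<in> P \<and> v \<in> P \<and> f i v = v1 \<and> f j u = u1"
proof (cases "\<exists>u\<in>P. \<exists>v\<in>P. f i v = v1 \<and> f j u = u1")
  case True
  then obtain u0 v0 where uv0: "u0 \<in> P" "v0 \<in> P" "f i v0 = v1" "f j u0 = u1"
    by auto
  have unique: "u = u0 \<and> v = v0" if "f i v = v1" "f j u = u1" for u v
    using that uv0 map_eq_iff[OF ij(1), of v v0] map_eq_iff[OF ij(2), of u u0] by simp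
  have "(THE q. \<exists>u\<in>P. \<exists>v\<in>P. q = S u v \<and> f i v = v1 \<and> f j u = u1) = S u0 v0"
  proof (rule the_equality)
    show "\<exists>u\<in>P. \<exists>v\<in>P. S u0 v0 = S u v \<and> f i v = v1 \<and> f j u = u1"
      using uv0 by (intro bexI[of _ u0] bexI[of _ v0]) simp_all
  next
    fix q assume "\<exists>u\<in>P. \<exists>v\<in>P. q = S u v \<and> f i v = v1 \<and> f j u = u1"
    then obtain u v where "q = S u v" "f i v = v1" "f j u = u1"
      by (elim bexE conjE)
    then show "q = S u0 v0"
      using unique[of v u] by simp
  qed
  then have "transition N f K (S u1 v1) (i, j) = S u0 v0"
    by (simp only: transition.simps if_P[OF True])
  moreover have "S u0 v0 = S u v \<longleftrightarrow> u \<in> P \<and> v \<in> P \<and> f i v = v1 \<and> f j u = u1"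
    unfolding state.inject using uv0 unique[of v u] by metis
  ultimately show ?thesis
    by (simp only:)
next
  case False
  then have "transition N f K (S u1 v1) (i, j) = Exit"
    by (simp only: transition.simps if_False)
  with False show ?thesis
    by (simp only: state.distinct) blast
qed

end

text \<open>A coding \<open>w\<close> of a post-critical point \<open>v\<close> is a coding of \<open>\<beta> v\<close>, since every tail of \<open>w\<close>
  codes a post-critical point. Two codings of one point that first differ at position \<open>n\<close> code
  post-critical points from position \<open>n + 1\<close> on.\<close>

lemma coding_map_transfer:
  assumes F: "similitude_ifs N f K r" and G: "similitude_ifs N g K' r'"
    and \<beta>: "\<And>v. v \<in> post_critical_set N f K \<Longrightarrow> \<beta> v \<in> post_critical_set N g K'"
    and critical: "\<And>i j u v. \<lbrakk>i \<in> {1..N}; j \<in> {1..N}; i \<noteq> j; u \<in> post_critical_set N f K;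
      v \<in> post_critical_set N f K; f i v = f j u\<rbrakk> \<Longrightarrow> g i (\<beta> v) = g j (\<beta> u)"
    and post: "\<And>i v. \<lbrakk>i \<in> {1..N}; v \<in> post_critical_set N f K; f i v \<in> post_critical_set N f K\<rbrakk>
      \<Longrightarrow> \<beta> (f i v) = g i (\<beta> v)"
    and xy: "x \<in> infinite_words N" "y \<in> infinite_words N" "coding_map f K x = coding_map f K y"
  shows "coding_map g K' x = coding_map g K' y"
proof (cases "x = y")
  case False
  interpret F: similitude_ifs N f K r by (rule F)
  interpret G: similitude_ifs N g K' r' by (rule G)
  have P: "G.\<pi> w = \<beta> (F.\<pi> w)" if w: "w \<in> infinite_words N" and "F.\<pi> w \<in> F.P" for w
  proof (rule G.coding_map_eqI[OF w])
    fix n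
    let ?t = "\<lambda>n. F.\<pi> (\<lambda>k. w (n + k))"
    have "?t n \<in> F.P \<and> \<beta> (F.\<pi> w) = word_map g (map w [0..<n]) (\<beta> (?t n))"
    proof (induction n)
      case 0
      then show ?case using that by simp
    next
      case (Suc n)
      have eq: "?t n = f (w n) (?t (Suc n))"
        using F.coding_map_Suc[OF infinite_words_shift[OF w, of n]] by simp
      moreover have "?t (Suc n) \<in> K"
        by (intro F.coding_map_in_K infinite_words_shift w)
      ultimately have "?t (Suc n) \<in> F.P"
        using Suc F.post_critical_preimage[OF infinite_words_nth[OF w]] by metis
      moreover from this have "\<beta> (?t n) = g (w n) (\<beta> (?t (Suc n)))"
        using Suc eq post[OF infinite_words_nth[OF w]] by metis
      ultimately show ?case
        using Suc by (simp add: word_map_append)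
    qed
    moreover from this have "\<beta> (?t n) \<in> K'"
      using \<beta> G.post_critical_in_K by blast
    ultimately show "\<beta> (F.\<pi> w) \<in> word_map g (map w [0..<n]) ` K'"
      by blast
  qed
  define n where "n = (LEAST n. x n \<noteq> y n)"
  have "\<exists>n. x n \<noteq> y n"
    using False by auto
  then have n: "x n \<noteq> y n"
    unfolding n_def by (rule LeastI_ex)
  have eq: "map x [0..<n] = map y [0..<n]"
    by (auto simp: n_def dest: not_less_Least)
  define x' where "x' = (\<lambda>k. x (Suc n + k))"
  define y' where "y' = (\<lambda>k. y (Suc n + k))"
  have xy': "x' \<in> infinite_words N" "y' \<in> infinite_words N"
    unfolding x'_def y'_def by (intro infinite_words_shift xy)+
  have Fx: "F.\<pi> x = word_map f (map x [0..<n]) (f (x n) (F.\<pi> x'))"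
    and Fy: "F.\<pi> y = word_map f (map y [0..<n]) (f (y n) (F.\<pi> y'))"
    using F.coding_map_shift[OF xy(1), of "Suc n"] F.coding_map_shift[OF xy(2), of "Suc n"]
    by (simp_all add: word_map_append x'_def y'_def)
  have Gx: "G.\<pi> x = word_map g (map x [0..<n]) (g (x n) (G.\<pi> x'))"
    and Gy: "G.\<pi> y = word_map g (map y [0..<n]) (g (y n) (G.\<pi> y'))"
    using G.coding_map_shift[OF xy(1), of "Suc n"] G.coding_map_shift[OF xy(2), of "Suc n"]
    by (simp_all add: word_map_append x'_def y'_def)
  \<comment> \<open>The map of the common prefix is injective and cancels, leaving a common point of
    the pieces of two different letters.\<close>
  have F_eq: "f (x n) (F.\<pi> x') = f (y n) (F.\<pi> y')"
    using Fx Fy xy(3) eq F.word_map_eq_iff[OF map_upt_in_lists[OF xy(1)]] by metis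
  moreover have "F.\<pi> x' \<in> K" "F.\<pi> y' \<in> K"
    by (intro F.coding_map_in_K xy')+
  moreover have letters: "x n \<in> {1..N}" "y n \<in> {1..N}"
    by (rule infinite_words_nth[OF xy(1)], rule infinite_words_nth[OF xy(2)])
  ultimately have "F.\<pi> x' \<in> F.P" "F.\<pi> y' \<in> F.P"
    using n F.post_critical_of_critical[of "x n" "y n"] F.post_critical_of_critical[of "y n" "x n"]
    by metis+
  then have "g (x n) (G.\<pi> x') = g (y n) (G.\<pi> y')"
    using critical[OF letters n] F_eq P xy' by simp
  then show ?thesis
    using Gx Gy eq by simp
qed simp

text \<open>\<open>h\<close> sends the point that \<open>w\<close> codes in \<open>K\<close> to the
  point that \<open>w\<close> codes in \<open>K'\<close>. \<open>coding_map_transfer\<close> for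
  \<beta> makes it well defined, and for the inverse of \<beta> injective. Prefixing a letter to the
  codings gives the conjugacy.\<close>

lemma same_topology_automaton_conjugacy:
  assumes F: "pcf_ifs N f K r" and G: "pcf_ifs N g K' r'"
    and same: "same_topology_automaton N f K g K'"
  obtains h where "bij_betw h K K'" "\<And>i p. i \<in> {1..N} \<Longrightarrow> p \<in> K \<Longrightarrow> h (f i p) = g i (h p)"
proof -
  interpret F: pcf_ifs N f K r by (rule F)
  interpret G: pcf_ifs N g K' r' by (rule G)
  obtain \<beta> where \<beta>: "bij_betw \<beta> F.P G.P"
    and all: "\<forall>q\<in>states (topology_automaton N f K). \<forall>a\<in>alphabet (topology_automaton N f K).
      trans_fun (topology_automaton N g K') (map_state \<beta> q) a =
      map_state \<beta> (trans_fun (topology_automaton N f K) q a)"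
    using same unfolding same_topology_automaton_def by (elim exE conjE)
  have trans: "transition N g K' (map_state \<beta> q) (i, j) = map_state \<beta> (transition N f K q (i, j))"
    if "q = Ident \<or> (\<exists>u\<in>F.P. \<exists>v\<in>F.P. q = S u v)" "i \<in> {1..N}" "j \<in> {1..N}" for q i j
  proof -
    have "q \<in> states (topology_automaton N f K)" "(i, j) \<in> alphabet (topology_automaton N f K)"
      using that by (auto simp: topology_automaton_def)
    then have "trans_fun (topology_automaton N g K') (map_state \<beta> q) (i, j) =
      map_state \<beta> (trans_fun (topology_automaton N f K) q (i, j))"
      using all by blast
    then show ?thesis
      by (simp only: topology_automaton_def automaton.select_convs)
  qed
  have \<beta>_mem: "\<beta> v \<in> G.P" if "v \<in> F.P" for v
    using \<beta> that by (auto simp: bij_betw_def)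
  have \<beta>_eq: "\<beta> u = \<beta> v \<longleftrightarrow> u = v" if "u \<in> F.P" "v \<in> F.P" for u v
    using \<beta> that by (auto simp: bij_betw_def inj_on_eq_iff)
  have critical: "g i (\<beta> v) = g j (\<beta> u) \<longleftrightarrow> f i v = f j u"
    if ij: "i \<in> {1..N}" "j \<in> {1..N}" "i \<noteq> j" and uv: "u \<in> F.P" "v \<in> F.P" for i j u v
  proof -
    have "g i (\<beta> v) = g j (\<beta> u) \<longleftrightarrow> map_state \<beta> (transition N f K Ident (i, j)) = S (\<beta> u) (\<beta> v)"
      using G.transition_Ident_eq_S_iff[OF ij, of "\<beta> u" "\<beta> v"] trans[of Ident i j] ij
        \<beta>_mem[OF uv(1)] \<beta>_mem[OF uv(2)]
      by (simp only: state.map simp_thms)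
    also have "\<dots> \<longleftrightarrow> transition N f K Ident (i, j) = S u v"
    proof
      assume "map_state \<beta> (transition N f K Ident (i, j)) = S (\<beta> u) (\<beta> v)"
      then obtain a b where ab: "transition N f K Ident (i, j) = S a b" "\<beta> a = \<beta> u" "\<beta> b = \<beta> v"
        by (cases "transition N f K Ident (i, j)") simp_all
      \<comment> \<open>\<beta> is injective on the post-critical set only, so \<open>a\<close> and
        \<open>b\<close> must first be recognised as post-critical; the transition itself guarantees
        this.\<close>
      then show "transition N f K Ident (i, j) = S u v"
        using F.transition_Ident_eq_S_iff[OF ij, of a b] \<beta>_eq uv by metis
    qed simp
    finally show ?thesis
      using F.transition_Ident_eq_S_iff[OF ij, of u v] uv by metis
  qed
  \<comment> \<open>The diagonal state \<open>S v v\<close> moves under \<open>(i, i)\<close> to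
    \<open>S w w\<close> exactly when \<open>v = f i w\<close>, so the automaton also records the
    preimages of single post-critical points.\<close>
  have post: "\<beta> v = g i (\<beta> w) \<longleftrightarrow> v = f i w"
    if i: "i \<in> {1..N}" and vw: "v \<in> F.P" "w \<in> F.P" for i v w
  proof -
    have "\<beta> v = g i (\<beta> w) \<longleftrightarrow> map_state \<beta> (transition N f K (S v v) (i, i)) = S (\<beta> w) (\<beta> w)"
      using G.transition_S_eq_S_iff[OF i i, of "\<beta> v" "\<beta> v" "\<beta> w" "\<beta> w"] trans[of "S v v" i i]
        i vw \<beta>_mem[OF vw(1)] \<beta>_mem[OF vw(2)]
      by (simp only: state.map) metis
    also have "\<dots> \<longleftrightarrow> transition N f K (S v v) (i, i) = S w w"
    proof
      assume "map_state \<beta> (transition N f K (S v v) (i, i)) = S (\<beta> w) (\<beta> w)"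
      then obtain a b where ab: "transition N f K (S v v) (i, i) = S a b" "\<beta> a = \<beta> w" "\<beta> b = \<beta> w"
        by (cases "transition N f K (S v v) (i, i)") simp_all
      then show "transition N f K (S v v) (i, i) = S w w"
        using F.transition_S_eq_S_iff[OF i i, of v v a b] \<beta>_eq vw by metis
    qed simp
    finally show ?thesis
      using F.transition_S_eq_S_iff[OF i i, of v v w w] vw by metis
  qed
  define \<gamma> where "\<gamma> = the_inv_into F.P \<beta>"
  have \<gamma>: "\<gamma> v \<in> F.P \<and> \<beta> (\<gamma> v) = v" if "v \<in> G.P" for v
    using that \<beta> the_inv_into_into[of \<beta> F.P v] f_the_inv_into_f[of \<beta> F.P v]
    by (simp add: \<gamma>_def bij_betw_def)
  have "G.\<pi> x = G.\<pi> y"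
    if "x \<in> infinite_words N" "y \<in> infinite_words N" "F.\<pi> x = F.\<pi> y" for x y
    by (rule coding_map_transfer[OF F.similitude_ifs_axioms G.similitude_ifs_axioms, of \<beta>])
      (use that \<beta>_mem critical post in blast)+
  \<comment> \<open>\<open>critical\<close> and \<open>post\<close> are equivalences, so at points
    \<gamma> \<open>u\<close>, \<gamma> \<open>v\<close> they supply the hypotheses of the transfer
    from \<open>g\<close> back to \<open>f\<close>.\<close>
  moreover have "F.\<pi> x = F.\<pi> y"
    if "x \<in> infinite_words N" "y \<in> infinite_words N" "G.\<pi> x = G.\<pi> y" for x y
  proof (rule coding_map_transfer[OF G.similitude_ifs_axioms F.similitude_ifs_axioms, of \<gamma>])
    show "f i (\<gamma> v) = f j (\<gamma> u)" if "i \<in> {1..N}" "j \<in> {1..N}" "i \<noteq> j" "u \<in> G.P" "v \<in> G.P"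
      "g i v = g j u" for i j u v
      using critical[OF that(1-3), of "\<gamma> u" "\<gamma> v"] \<gamma> that by metis
    show "\<gamma> (g i v) = f i (\<gamma> v)" if "i \<in> {1..N}" "v \<in> G.P" "g i v \<in> G.P" for i v
      using post[OF that(1), of "\<gamma> (g i v)" "\<gamma> v"] \<gamma> that by metis
  qed (use that \<gamma> in blast)+
  ultimately have \<pi>_eq: "G.\<pi> x = G.\<pi> y \<longleftrightarrow> F.\<pi> x = F.\<pi> y"
    if "x \<in> infinite_words N" "y \<in> infinite_words N" for x y
    using that by blast
  \<comment> \<open>The choice of the coding is immaterial by \<open>\<pi>_eq\<close>.\<close>
  define h where "h p = G.\<pi> (SOME w. w \<in> infinite_words N \<and> F.\<pi> w = p)" for p
  have h: "h (F.\<pi> w) = G.\<pi> w" if w: "w \<in> infinite_words N" for w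
  proof -
    let ?x = "SOME x. x \<in> infinite_words N \<and> F.\<pi> x = F.\<pi> w"
    have "?x \<in> infinite_words N \<and> F.\<pi> ?x = F.\<pi> w"
      by (rule someI[of _ w]) (simp add: w)
    then show ?thesis
      using \<pi>_eq w unfolding h_def by blast
  qed
  have "bij_betw h K K'"
  proof (rule bij_betw_imageI)
    show "inj_on h K"
    proof (rule inj_onI)
      fix p q assume "p \<in> K" "q \<in> K" "h p = h q"
      then show "p = q"
        using F.coding_map_surj \<pi>_eq h by metis
    qed
    show "h ` K = K'"
    proof (intro set_eqI iffI)
      fix q assume "q \<in> K'"
      then obtain w where w: "w \<in> infinite_words N" "G.\<pi> w = q"
        using G.coding_map_surj by blast
      then show "q \<in> h ` K"
        using h F.coding_map_in_K by (intro image_eqI[of _ _ "F.\<pi> w"]) simp_all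
    next
      fix q assume "q \<in> h ` K"
      then obtain p where "p \<in> K" "q = h p"
        by blast
      then show "q \<in> K'"
        using F.coding_map_surj h G.coding_map_in_K by metis
    qed
  qed
  moreover have "h (f i p) = g i (h p)" if i: "i \<in> {1..N}" and "p \<in> K" for i p
  proof -
    obtain w where w: "w \<in> infinite_words N" "F.\<pi> w = p"
      using F.coding_map_surj \<open>p \<in> K\<close> by blast
    then show ?thesis
      using h[OF infinite_words_case_nat[OF i w(1)]] h[OF w(1)]
      by (simp only: F.coding_map_case_nat[OF i w(1)] G.coding_map_case_nat[OF i w(1)])
  qed
  ultimately show thesis
    by (rule that)
qed

section \<open>Distances up to a snowflake transform\<close>

text \<open>Take the minimum of the finitely many constants; including 1 yields
  \<open>c \<le> 1\<close> and covers an empty \<open>A\<close>.\<close>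

lemma finite_uniform_constant:
  fixes Q :: "'a \<Rightarrow> real \<Rightarrow> bool"
  assumes "finite A" and ex: "\<And>a. a \<in> A \<Longrightarrow> \<exists>c>0. Q a c"
    and mono: "\<And>a c d. Q a c \<Longrightarrow> d \<le> c \<Longrightarrow> Q a d"
  obtains c where "0 < c" "c \<le> 1" "\<And>a. a \<in> A \<Longrightarrow> Q a c"
proof -
  obtain C where C: "\<And>a. a \<in> A \<Longrightarrow> C a > 0 \<and> Q a (C a)"
    using ex by metis
  let ?c = "Min (insert 1 (C ` A))"
  have fin: "finite (insert 1 (C ` A))"
    using \<open>finite A\<close> by simp
  have "0 < ?c"
    using fin C by (subst Min_gr_iff) auto
  moreover have "?c \<le> 1"
    using fin by (intro Min_le) auto
  moreover have "Q a ?c" if "a \<in> A" for a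
  proof (rule mono)
    show "Q a (C a)" using C[OF that] by simp
    show "?c \<le> C a" using fin that by (intro Min_le) auto
  qed
  ultimately show thesis by (rule that)
qed

text \<open>The distance attains its minimum on the compact product, and disjointness makes it
  positive. If the product is empty, 1 serves.\<close>

lemma compact_disjoint_separated:
  fixes A B :: "'a::metric_space set"
  assumes "compact A" "compact B" "A \<inter> B = {}"
  shows "\<exists>c>0. \<forall>p\<in>A. \<forall>q\<in>B. c \<le> dist p q"
proof (cases "A \<times> B = {}")
  case True
  then have "\<forall>p\<in>A. \<forall>q\<in>B. 1 \<le> dist p q" by auto
  then show ?thesis by (intro exI[of _ 1]) simp
next
  case False
  have "\<exists>x\<in>A \<times> B. \<forall>y\<in>A \<times> B. dist (fst x) (snd x) \<le> dist (fst y) (snd y)"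
    using assms False by (intro continuous_attains_inf compact_Times continuous_intros)
  then obtain x where x: "x \<in> A \<times> B" "\<forall>y\<in>A \<times> B. dist (fst x) (snd x) \<le> dist (fst y) (snd y)"
    by blast
  have "dist (fst x) (snd x) > 0"
    using x(1) assms(3) by auto
  moreover have "\<forall>p\<in>A. \<forall>q\<in>B. dist (fst x) (snd x) \<le> dist p q"
    using x(2) by auto
  ultimately show ?thesis by blast
qed

text \<open>\<open>b\<close> equals the snowflaked quantity \<open>a powr s\<close> up to the factor
  \<open>A\<close>. One constant for both bounds keeps rescaling and weakening simple.\<close>

definition comparable :: "real \<Rightarrow> real \<Rightarrow> real \<Rightarrow> real \<Rightarrow> bool" where
  "comparable s A a b \<longleftrightarrow> a powr s \<le> A * b \<and> b \<le> A * a powr s"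

lemma comparable_mono: "comparable s A a b \<Longrightarrow> A \<le> B \<Longrightarrow> 0 \<le> b \<Longrightarrow> comparable s B a b"
  unfolding comparable_def by (smt (verit, best) mult_right_mono powr_ge_zero)

text \<open>The constant \<open>A\<close> is unchanged, which lets an estimate pass through
  cylinders of any depth.\<close>

lemma comparable_scale:
  assumes "comparable s A a b" "0 \<le> a" "0 \<le> \<rho>" and "\<rho>' = \<rho> powr s"
  shows "comparable s A (\<rho> * a) (\<rho>' * b)"
proof -
  have "\<rho> powr s * a powr s \<le> \<rho> powr s * (A * b)" "\<rho> powr s * b \<le> \<rho> powr s * (A * a powr s)"
    using assms(1) by (auto simp: comparable_def intro!: mult_left_mono)
  then show ?thesis
    using assms(2-) by (simp add: comparable_def powr_mult ac_simps)
qed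

text \<open>Quantities bounded above and away from 0 are comparable for every positive exponent;
  each summand of the constant serves one of the two bounds.\<close>

lemma comparable_bounded:
  assumes "0 < c" "c \<le> a" "a \<le> D" "0 < c'" "c' \<le> b" "b \<le> D'" "0 < s"
  shows "comparable s (D powr s / c' + D' / c powr s) a b"
proof -
  have "a powr s \<le> D powr s"
    using assms by (intro powr_mono2) auto
  also have "\<dots> \<le> D powr s / c' * b"
    using mult_left_mono[OF assms(5), of "D powr s / c'"] assms(4) by simp
  finally have 1: "a powr s \<le> D powr s / c' * b" .
  have "c powr s \<le> a powr s"
    using assms by (intro powr_mono2) auto
  then have "D' / c powr s * c powr s \<le> D' / c powr s * a powr s"
    using assms by (intro mult_left_mono) auto
  then have 2: "b \<le> D' / c powr s * a powr s"
    using assms by simp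
  have "0 \<le> D' / c powr s * b" "0 \<le> D powr s / c' * a powr s"
    using assms by auto
  with 1 2 show ?thesis
    by (simp add: comparable_def distrib_right)
qed

text \<open>Two points of pieces meeting only in \<open>z\<close>: by the angle separation condition their distance
  is comparable to the larger one of their distances \<open>a\<close>, \<open>b\<close> to \<open>z\<close>.\<close>

lemma comparable_angle:
  assumes A: "comparable s A a a'" "comparable s A b b'" "0 < A" and s: "0 < s"
    and nonneg: "0 \<le> a" "0 \<le> b" "0 \<le> a'" "0 \<le> b'"
    and d: "d \<le> a + b" "c * a \<le> d" "c * b \<le> d" "0 < c"
    and d': "d' \<le> a' + b'" "c' * a' \<le> d'" "c' * b' \<le> d'" "0 < c'"
  shows "comparable s (2 powr s * A / c' + 2 * A / c powr s) d d'"
proof -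
  have nn: "0 \<le> d" "0 \<le> d'"
    using d d' nonneg by (smt (verit) mult_nonneg_nonneg)+
  \<comment> \<open>The first summand arises along the chain from \<open>d\<close> to
    \<open>2 * max a b\<close>, then by comparability to \<open>max a' b'\<close>, then to
    \<open>d' / c'\<close>.\<close>
  have "d powr s \<le> (2 * max a b) powr s"
    using nn d(1) s by (intro powr_mono2) auto
  also have "\<dots> = 2 powr s * max a b powr s"
    using nonneg by (simp add: powr_mult)
  also have "max a b powr s \<le> A * max a' b'"
    using A by (smt (verit) comparable_def mult_left_mono max_def)
  also have "max a' b' \<le> d' / c'"
    using d' by (simp add: field_simps)
  finally have 1: "d powr s \<le> 2 powr s * A / c' * d'"
    using A(3) by simp
  \<comment> \<open>Both \<open>a\<close> and \<open>b\<close> are at most \<open>d / c\<close>;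
    with \<open>d' \<le> a' + b'\<close> this yields the second summand.\<close>
  have le: "x powr s \<le> d powr s / c powr s" if "c * x \<le> d" "0 \<le> x" for x
  proof -
    have "x powr s \<le> (d / c) powr s"
      using that d(4) s by (intro powr_mono2) (auto simp: field_simps)
    then show ?thesis
      using nn d(4) by (simp add: powr_divide)
  qed
  have "d' \<le> A * a powr s + A * b powr s"
    using A d'(1) by (simp add: comparable_def)
  also have "\<dots> \<le> A * (d powr s / c powr s) + A * (d powr s / c powr s)"
    using A(3) le d nonneg by (intro add_mono mult_left_mono) auto
  finally have 2: "d' \<le> 2 * A / c powr s * d powr s"
    by simp
  have "0 \<le> 2 * A / c powr s * d'" "0 \<le> 2 powr s * A / c' * d powr s"
    using nn A(3) d'(4) by auto
  with 1 2 show ?thesis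
    by (simp add: comparable_def distrib_right)
qed

section \<open>Uniform separation of pieces and post-critical points\<close>

context pcf_ifs
begin

lemma SIC_unique:
  "\<lbrakk>i \<in> {1..N}; j \<in> {1..N}; i \<noteq> j; x \<in> f i ` K; x \<in> f j ` K; y \<in> f i ` K; y \<in> f j ` K\<rbrakk> \<Longrightarrow> x = y"
  using SIC[unfolded SIC_def, rule_format, of i j x y] by blast

text \<open>One constant serves three purposes: the gap between disjoint pieces, the gap between a
  piece and a post-critical point outside it, and the angle at a common point of two pieces. The
  bound \<open>c \<le> 1\<close> allows passing from \<open>c\<close> to
  \<open>c * c\<close>.\<close>

definition separating :: "real \<Rightarrow> bool" where
  "separating c \<longleftrightarrow> 0 < c \<and> c \<le> 1 \<and>
    (\<forall>i\<in>{1..N}. \<forall>j\<in>{1..N}. f i ` K \<inter> f j ` K = {} \<longrightarrow>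
      (\<forall>p\<in>f i ` K. \<forall>q\<in>f j ` K. c \<le> dist p q)) \<and>
    (\<forall>i\<in>{1..N}. \<forall>v\<in>P. v \<notin> f i ` K \<longrightarrow> (\<forall>p\<in>f i ` K. c \<le> dist p v)) \<and>
    (\<forall>i\<in>{1..N}. \<forall>j\<in>{1..N}. i \<noteq> j \<longrightarrow> (\<forall>z\<in>f i ` K \<inter> f j ` K. \<forall>p\<in>f i ` K. \<forall>q\<in>f j ` K.
      c * dist p z \<le> dist p q \<and> c * dist q z \<le> dist p q))"

lemma separating_pos: "separating c \<Longrightarrow> 0 < c"
  and separating_le_1: "separating c \<Longrightarrow> c \<le> 1"
  and separating_gap: "\<lbrakk>separating c; i \<in> {1..N}; j \<in> {1..N}; f i ` K \<inter> f j ` K = {};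
    p \<in> f i ` K; q \<in> f j ` K\<rbrakk> \<Longrightarrow> c \<le> dist p q"
  and separating_vertex: "\<lbrakk>separating c; i \<in> {1..N}; v \<in> P; v \<notin> f i ` K; p \<in> f i ` K\<rbrakk>
    \<Longrightarrow> c \<le> dist p v"
  and separating_angle: "\<lbrakk>separating c; i \<in> {1..N}; j \<in> {1..N}; i \<noteq> j; z \<in> f i ` K; z \<in> f j ` K;
    p \<in> f i ` K; q \<in> f j ` K\<rbrakk> \<Longrightarrow> c * dist p z \<le> dist p q \<and> c * dist q z \<le> dist p q"
  unfolding separating_def by blast+

text \<open>There are finitely many pieces and post-critical points, hence finitely many disjoint
  compact pairs to separate, collected in \<X>. The angle bound is the ASC, and by the SIC a common
  point \<open>z\<close> of two pieces is their whole intersection.\<close>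

lemma separating_exists: obtains c where "separating c"
proof -
  define separated where
    "separated X c \<longleftrightarrow> (\<forall>p\<in>fst X. \<forall>q\<in>snd X. c \<le> dist p q)" for X :: "'a set \<times> 'a set" and c
  define \<A> where "\<A> = (\<lambda>i. f i ` K) ` {1..N}"
  define \<X> where "\<X> = {X \<in> \<A> \<times> (\<A> \<union> (\<lambda>v. {v}) ` P). fst X \<inter> snd X = {}}"
  have "finite \<X>"
    unfolding \<X>_def \<A>_def by (intro finite_Collect_conjI disjI1)
      (simp add: finite_post_critical_set[OF pcf])
  moreover have "\<exists>c>0. separated X c" if "X \<in> \<X>" for X
  proof -
    have "compact X" if "X \<in> \<A>" for X
      using that compact_map_image by (auto simp only: \<A>_def)
    then have "compact (fst X)" "compact (snd X)" "fst X \<inter> snd X = {}"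
      using that by (auto simp: \<X>_def)
    then show ?thesis
      unfolding separated_def by (rule compact_disjoint_separated)
  qed
  ultimately obtain c0 where c0: "0 < c0" "c0 \<le> 1" "\<And>X. X \<in> \<X> \<Longrightarrow> separated X c0"
    by (rule finite_uniform_constant) (auto simp: separated_def intro: order_trans)
  obtain c1 where "0 < c1" and c1: "\<forall>i\<in>{1..N}. \<forall>j\<in>{1..N}. \<forall>z. i \<noteq> j \<and> f i ` K \<inter> f j ` K = {z} \<longrightarrow>
      (\<forall>x\<in>f i ` K. \<forall>y\<in>f j ` K. dist x y \<ge> c1 * max (dist x z) (dist y z))"
    using ASC unfolding ASC_def by blast
  have "separating (min c0 c1)"
    unfolding separating_def
  proof (intro conjI ballI impI)
    show "0 < min c0 c1" "min c0 c1 \<le> 1"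
      using c0(1,2) \<open>0 < c1\<close> by auto
  next
    fix i j p q
    assume *: "i \<in> {1..N}" "j \<in> {1..N}" "f i ` K \<inter> f j ` K = {}" "p \<in> f i ` K" "q \<in> f j ` K"
    then have "(f i ` K, f j ` K) \<in> \<X>"
      unfolding \<X>_def \<A>_def by simp
    then have "c0 \<le> dist p q"
      using c0(3) * unfolding separated_def by fastforce
    then show "min c0 c1 \<le> dist p q"
      by simp
  next
    fix i v p
    assume *: "i \<in> {1..N}" "v \<in> P" "v \<notin> f i ` K" "p \<in> f i ` K"
    then have "(f i ` K, {v}) \<in> \<X>"
      unfolding \<X>_def \<A>_def by simp
    then have "c0 \<le> dist p v"
      using c0(3) * unfolding separated_def by fastforce
    then show "min c0 c1 \<le> dist p v"
      by simp
  next
    fix i j z p q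
    assume *: "i \<in> {1..N}" "j \<in> {1..N}" "i \<noteq> j" "z \<in> f i ` K \<inter> f j ` K" "p \<in> f i ` K" "q \<in> f j ` K"
    have "f i ` K \<inter> f j ` K = {z}"
      using SIC_unique[OF *(1-3)] *(4) by blast
    then have "c1 * max (dist p z) (dist q z) \<le> dist p q"
      using c1 * by blast
    moreover have "min c0 c1 * dist p z \<le> c1 * max (dist p z) (dist q z)"
      "min c0 c1 * dist q z \<le> c1 * max (dist p z) (dist q z)"
      using \<open>0 < c1\<close> by (intro mult_mono; simp)+
    ultimately show "min c0 c1 * dist p z \<le> dist p q" "min c0 c1 * dist q z \<le> dist p q"
      by linarith+
  qed
  then show thesis
    by (rule that)
qed

text \<open>Read \<tau> as long as the current pull-back of \<open>v\<close> lies in the piece of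
  the next letter. All pull-backs remain post-critical, so every letter read is a boundary
  letter.\<close>

lemma post_critical_prefix:
  assumes "v \<in> P" "\<tau> \<in> lists {1..N}"
  obtains \<tau>\<^sub>1 \<tau>\<^sub>2 v\<^sub>1 where "\<tau> = \<tau>\<^sub>1 @ \<tau>\<^sub>2" "set \<tau>\<^sub>1 \<subseteq> boundary_letters N f K" "v\<^sub>1 \<in> P"
    "v = word_map f \<tau>\<^sub>1 v\<^sub>1" "\<tau>\<^sub>2 = [] \<or> v\<^sub>1 \<notin> f (hd \<tau>\<^sub>2) ` K"
proof -
  have "\<exists>\<tau>\<^sub>1 \<tau>\<^sub>2 v\<^sub>1. \<tau> = \<tau>\<^sub>1 @ \<tau>\<^sub>2 \<and> set \<tau>\<^sub>1 \<subseteq> boundary_letters N f K \<and> v\<^sub>1 \<in> P \<and>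
      v = word_map f \<tau>\<^sub>1 v\<^sub>1 \<and> (\<tau>\<^sub>2 = [] \<or> v\<^sub>1 \<notin> f (hd \<tau>\<^sub>2) ` K)"
    using assms(2,1)
  proof (induction \<tau> arbitrary: v rule: lists.induct)
    case Nil
    then show ?case
      by (intro exI[of _ "[]"] exI[of _ v]) simp
  next
    case (Cons i \<tau>)
    show ?case
    proof (cases "v \<in> f i ` K")
      case True
      then obtain w where w: "w \<in> K" "v = f i w"
        by blast
      then have "w \<in> P" "i \<in> boundary_letters N f K"
        using Cons post_critical_preimage[of i w] boundary_letterI[of i w] by metis+
      with Cons.IH[of w] obtain \<tau>\<^sub>1 \<tau>\<^sub>2 v\<^sub>1 where "\<tau> = \<tau>\<^sub>1 @ \<tau>\<^sub>2" "set \<tau>\<^sub>1 \<subseteq> boundary_letters N f K" "v\<^sub>1 \<in> P"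
        "w = word_map f \<tau>\<^sub>1 v\<^sub>1" "\<tau>\<^sub>2 = [] \<or> v\<^sub>1 \<notin> f (hd \<tau>\<^sub>2) ` K"
        by metis
      then show ?thesis
        using w \<open>i \<in> boundary_letters N f K\<close>
        by (intro exI[of _ "i # \<tau>\<^sub>1"] exI[of _ \<tau>\<^sub>2] exI[of _ v\<^sub>1]) simp
    next
      case False
      then show ?thesis
        using Cons.prems by (intro exI[of _ "[]"] exI[of _ "i # \<tau>"] exI[of _ v]) simp
    qed
  qed
  then show thesis
    using that by metis
qed

lemma word_map_hd_image:
  assumes "\<tau> \<in> lists {1..N}" "\<tau> \<noteq> []" "p \<in> K"
  shows "word_map f \<tau> p \<in> f (hd \<tau>) ` K"
proof -
  obtain i \<sigma> where "\<tau> = i # \<sigma>"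
    using assms(2) by (cases \<tau>) simp_all
  then show ?thesis
    using assms(1,3) word_map_in_K[of \<sigma> p] by simp
qed

text \<open>Some prefix of a coding of \<open>p\<close> has a cylinder that misses \<open>v\<close>.
  Reading this prefix along \<open>v\<close> by \<open>post_critical_prefix\<close> stops early, at
  a letter whose piece contains the rescaled \<open>p\<close> but not the rescaled
  \<open>v\<close>.\<close>

lemma post_critical_split:
  assumes v: "v \<in> P" and p: "p \<in> K" "p \<noteq> v"
  obtains \<omega> i q u where "\<omega> \<in> lists {1..N}" "set \<omega> \<subseteq> boundary_letters N f K" "i \<in> {1..N}"
    "q \<in> f i ` K" "q \<in> K" "u \<in> P" "u \<notin> f i ` K" "p = word_map f \<omega> q" "v = word_map f \<omega> u"
proof -
  obtain w where w: "w \<in> infinite_words N" "\<pi> w = p"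
    using coding_map_surj[OF p(1)] by metis
  obtain n where n: "v \<notin> word_map f (map w [0..<n]) ` K"
    using coding_map_eqI[OF w(1), of v] w p by metis
  let ?p = "\<pi> (\<lambda>k. w (n + k))"
  have p': "?p \<in> K" "p = word_map f (map w [0..<n]) ?p"
    using coding_map_in_K[OF infinite_words_shift[OF w(1)]] coding_map_shift[OF w(1), of n] w(2)
    by simp_all
  obtain \<tau>\<^sub>1 \<tau>\<^sub>2 u where \<tau>: "map w [0..<n] = \<tau>\<^sub>1 @ \<tau>\<^sub>2" "set \<tau>\<^sub>1 \<subseteq> boundary_letters N f K" "u \<in> P"
    "v = word_map f \<tau>\<^sub>1 u" "\<tau>\<^sub>2 = [] \<or> u \<notin> f (hd \<tau>\<^sub>2) ` K"
    using post_critical_prefix[OF v map_upt_in_lists[OF w(1)]] by metis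
  have lists: "\<tau>\<^sub>1 \<in> lists {1..N}" "\<tau>\<^sub>2 \<in> lists {1..N}"
    using map_upt_in_lists[OF w(1), of 0 n] \<tau>(1) by simp_all
  \<comment> \<open>Otherwise the whole prefix would be read and \<open>v\<close> would lie in its
    cylinder.\<close>
  have ne: "\<tau>\<^sub>2 \<noteq> []"
    using n \<tau> post_critical_in_K by auto
  show thesis
  proof
    show "\<tau>\<^sub>1 \<in> lists {1..N}" "set \<tau>\<^sub>1 \<subseteq> boundary_letters N f K" "u \<in> P" "v = word_map f \<tau>\<^sub>1 u"
      by (fact lists \<tau>)+
    show "u \<notin> f (hd \<tau>\<^sub>2) ` K"
      using ne \<tau> by simp
    show "hd \<tau>\<^sub>2 \<in> {1..N}"
      using lists(2) ne by (cases \<tau>\<^sub>2) simp_all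
    show "word_map f \<tau>\<^sub>2 ?p \<in> f (hd \<tau>\<^sub>2) ` K"
      using lists(2) ne p' by (intro word_map_hd_image)
    show "word_map f \<tau>\<^sub>2 ?p \<in> K"
      using lists(2) p' by (intro word_map_in_K)
    show "p = word_map f \<tau>\<^sub>1 (word_map f \<tau>\<^sub>2 ?p)"
      using p'(2) \<tau>(1) by (simp add: word_map_append)
  qed
qed

end

section \<open>Distortion of distances by a conjugacy\<close>

locale ifs_conjugacy = F: pcf_ifs N f K r + G: pcf_ifs N g K' r'
  for N and f :: "nat \<Rightarrow> 'a \<Rightarrow> 'a::metric_space" and K r
    and g :: "nat \<Rightarrow> 'b \<Rightarrow> 'b::metric_space" and K' r' +
  fixes h :: "'a \<Rightarrow> 'b" and s :: real
  assumes bij: "bij_betw h K K'"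
    and conj: "i \<in> {1..N} \<Longrightarrow> p \<in> K \<Longrightarrow> h (f i p) = g i (h p)"
    and s_pos: "0 < s"
    and boundary: "i \<in> boundary_letters N f K \<Longrightarrow> r' i = r i powr s"
begin

lemma h_in_K: "p \<in> K \<Longrightarrow> h p \<in> K'"
  using bij by (auto simp: bij_betw_def)

lemma h_eq_iff: "p \<in> K \<Longrightarrow> q \<in> K \<Longrightarrow> h p = h q \<longleftrightarrow> p = q"
  using bij by (auto simp: bij_betw_def inj_on_eq_iff)

lemma h_surj: "y \<in> K' \<Longrightarrow> \<exists>p\<in>K. y = h p"
  using bij by (auto simp: bij_betw_def)

lemma h_word_map: "\<omega> \<in> lists {1..N} \<Longrightarrow> p \<in> K \<Longrightarrow> h (word_map f \<omega> p) = word_map g \<omega> (h p)"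
proof (induction \<omega> rule: lists.induct)
  case (Cons i \<omega>)
  then show ?case
    using conj[OF Cons(1) F.word_map_in_K[OF Cons(2)]] by simp
qed simp

text \<open>The conjugacy gives one direction; the other also needs \<open>h\<close> injective and
  onto \<open>K'\<close>.\<close>

lemma h_mem_image_iff:
  assumes "i \<in> {1..N}" "p \<in> K"
  shows "h p \<in> g i ` K' \<longleftrightarrow> p \<in> f i ` K"
proof
  assume "h p \<in> g i ` K'"
  then obtain q where "q \<in> K" "h p = g i (h q)"
    using h_surj by blast
  then have "h p = h (f i q)" "f i q \<in> K"
    using conj F.map_in_K assms by metis+
  then show "p \<in> f i ` K"
    using h_eq_iff assms \<open>q \<in> K\<close> by blast
next
  assume "p \<in> f i ` K"
  then obtain q where "q \<in> K" "p = f i q"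
    by blast
  then show "h p \<in> g i ` K'"
    using conj[OF assms(1)] h_in_K by auto
qed

lemma h_image_disjoint:
  assumes "i \<in> {1..N}" "j \<in> {1..N}" "f i ` K \<inter> f j ` K = {}"
  shows "g i ` K' \<inter> g j ` K' = {}"
proof (rule equals0I)
  fix y assume y: "y \<in> g i ` K' \<inter> g j ` K'"
  then obtain p where "p \<in> K" "y = h p"
    using h_surj G.map_in_K[OF assms(1)] by blast
  then show False
    using y h_mem_image_iff assms by blast
qed

text \<open>\<open>h\<close> matches pieces and word maps, so the word that brings \<open>v\<close>
  to a critical point also brings \<open>h v\<close> to one.\<close>

lemma h_post_critical:
  assumes v: "v \<in> F.P"
  shows "h v \<in> G.P"
proof -
  obtain \<omega> where \<omega>: "\<omega> \<in> finite_words N" "word_map f \<omega> v \<in> critical_set N f K" and vK: "v \<in> K"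
    using v by (auto simp: post_critical_set_def)
  have lists: "\<omega> \<in> lists {1..N}"
    using \<omega>(1) by (simp add: finite_words_def)
  obtain i j where ij: "i \<in> {1..N}" "j \<in> {1..N} - {i}" "word_map f \<omega> v \<in> f i ` K \<inter> f j ` K"
    using \<omega>(2) unfolding critical_set_def by blast
  then have "word_map g \<omega> (h v) \<in> g i ` K' \<inter> g j ` K'"
    using h_mem_image_iff F.word_map_in_K[OF lists vK] h_word_map[OF lists vK]
    by (metis DiffD1 IntE IntI)
  then have "word_map g \<omega> (h v) \<in> critical_set N g K'"
    using ij unfolding critical_set_def by blast
  then show ?thesis
    using \<omega>(1) h_in_K[OF vK] unfolding post_critical_set_def by blast
qed

text \<open>The hypothesis on the ratios enters here: along boundary letters the power relation is
  exact, with no loss that grows with the length of the word.\<close>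

lemma word_ratio_boundary:
  assumes "\<omega> \<in> lists {1..N}" "set \<omega> \<subseteq> boundary_letters N f K"
  shows "word_ratio r' \<omega> = word_ratio r \<omega> powr s"
  using assms
proof (induction \<omega> rule: lists.induct)
  case (Cons i \<omega>)
  then show ?case
    using F.ratio_pos[of i] F.word_ratio_pos[of \<omega>] boundary[of i] by (simp add: powr_mult)
qed simp

lemma dist_conjugate_word_map:
  assumes "\<omega> \<in> lists {1..N}" "p \<in> K" "q \<in> K"
  shows "dist (h (word_map f \<omega> p)) (h (word_map f \<omega> q)) = word_ratio r' \<omega> * dist (h p) (h q)"
  using assms by (simp only: h_word_map G.dist_word_map)

text \<open>Split off a common cylinder of \<open>p\<close> and \<open>v\<close>. Its word has
  boundary letters only and scales exactly; there remain a point of a piece and a post-critical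
  point outside that piece, whose distances in \<open>K\<close> and in \<open>K'\<close> are bounded
  above and below.\<close>

lemma post_critical_comparable:
  obtains A where "0 < A"
    "\<And>v p. v \<in> F.P \<Longrightarrow> p \<in> K \<Longrightarrow> comparable s A (dist p v) (dist (h p) (h v))"
proof -
  obtain c where c: "F.separating c"
    by (rule F.separating_exists)
  obtain c' where c': "G.separating c'"
    by (rule G.separating_exists)
  obtain D where D: "0 < D" "\<And>p q. p \<in> K \<Longrightarrow> q \<in> K \<Longrightarrow> dist p q \<le> D"
    using F.diameter_bound by blast
  obtain D' where D': "0 < D'" "\<And>p q. p \<in> K' \<Longrightarrow> q \<in> K' \<Longrightarrow> dist p q \<le> D'"
    using G.diameter_bound by blast
  let ?A = "D powr s / c' + D' / c powr s"
  have "comparable s ?A (dist p v) (dist (h p) (h v))" if v: "v \<in> F.P" and p: "p \<in> K" for v p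
  proof (cases "p = v")
    case True
    then show ?thesis by (simp add: comparable_def)
  next
    case False
    then obtain \<omega> i q u where *: "\<omega> \<in> lists {1..N}" "set \<omega> \<subseteq> boundary_letters N f K" "i \<in> {1..N}"
      "q \<in> f i ` K" "q \<in> K" "u \<in> F.P" "u \<notin> f i ` K" "p = word_map f \<omega> q" "v = word_map f \<omega> u"
      using F.post_critical_split[OF v p] by metis
    have u: "u \<in> K"
      using * F.post_critical_in_K by blast
    have "comparable s ?A (dist q u) (dist (h q) (h u))"
    proof (rule comparable_bounded[OF F.separating_pos[OF c] _ _ G.separating_pos[OF c'] _ _ s_pos])
      show "c \<le> dist q u" by (rule F.separating_vertex[OF c]) (fact *)+
      show "dist q u \<le> D" by (rule D(2)) (fact * u)+
      show "c' \<le> dist (h q) (h u)"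
        by (rule G.separating_vertex[OF c' *(3) h_post_critical[OF *(6)]])
          (simp_all only: h_mem_image_iff[OF *(3) u] h_mem_image_iff[OF *(3) *(5)] * not_False_eq_True)
      show "dist (h q) (h u) \<le> D'" by (rule D'(2); rule h_in_K; fact * u)
    qed
    then have "comparable s ?A (word_ratio r \<omega> * dist q u) (word_ratio r' \<omega> * dist (h q) (h u))"
      by (rule comparable_scale)
        (use * F.word_ratio_pos[of \<omega>] word_ratio_boundary[of \<omega>] in \<open>simp_all add: less_imp_le\<close>)
    then show ?thesis
      using * u by (simp only: F.dist_word_map dist_conjugate_word_map)
  qed
  moreover have "0 < ?A"
    using F.separating_pos[OF c] G.separating_pos[OF c'] D(1) D'(1) by (simp add: add_pos_pos)
  ultimately show thesis
    using that by blast
qed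

text \<open>A letter off the boundary may have ratios not related by the exponent \<open>s\<close>;
  passing one arbitrary letter costs a bounded factor.\<close>

lemma letter_comparable:
  obtains B where "1 \<le> B"
    "\<And>i A a b. \<lbrakk>i \<in> {1..N}; comparable s A a b; 0 \<le> A; 0 \<le> a; 0 \<le> b\<rbrakk>
      \<Longrightarrow> comparable s (B * A) (r i * a) (r' i * b)"
proof -
  obtain \<rho> where \<rho>: "0 < \<rho>" "\<rho> < 1" "\<And>i. i \<in> {1..N} \<Longrightarrow> \<rho> \<le> r i"
    using F.min_ratio by blast
  obtain \<rho>' where \<rho>': "0 < \<rho>'" "\<rho>' < 1" "\<And>i. i \<in> {1..N} \<Longrightarrow> \<rho>' \<le> r' i"
    using G.min_ratio by blast
  \<comment> \<open>Chosen so that \<open>?B * r' i \<ge> 1\<close> and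
    \<open>?B * r i powr s \<ge> 1\<close> for every letter \<open>i\<close>.\<close>
  let ?B = "1 / (\<rho>' * \<rho> powr s)"
  have \<rho>s: "0 < \<rho> powr s" "\<rho> powr s \<le> 1"
    using \<rho>(1,2) s_pos by (auto simp: powr_le1)
  have B: "1 \<le> ?B"
    using \<rho>s \<rho>' by (simp add: mult_le_one)
  moreover have "comparable s (?B * A) (r i * a) (r' i * b)"
    if i: "i \<in> {1..N}" and ab: "comparable s A a b" and nn: "0 \<le> A" "0 \<le> a" "0 \<le> b" for i A a b
  proof -
    have ri: "0 < r i" "r i \<le> 1" "\<rho> powr s \<le> r i powr s" "r i powr s \<le> 1"
      using F.ratio_pos[OF i] F.ratio_less_1[OF i] \<rho>(3)[OF i] \<rho>(1) s_pos
      by (auto intro: powr_mono2 powr_le1)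
    have ri': "0 < r' i" "r' i \<le> 1" "\<rho>' \<le> r' i"
      using G.ratio_pos[OF i] G.ratio_less_1[OF i] \<rho>'(3)[OF i] by auto
    have "\<rho>' * \<rho> powr s \<le> r' i * 1"
      using ri' \<rho>s by (intro mult_mono) auto
    then have 1: "1 \<le> ?B * r' i"
      using \<rho>s \<rho>'(1) by simp
    have "\<rho>' * \<rho> powr s \<le> 1 * r i powr s"
      using ri \<rho>s \<rho>'(1,2) by (intro mult_mono) auto
    then have 2: "1 \<le> ?B * r i powr s"
      using \<rho>s \<rho>'(1) by simp
    have "(r i * a) powr s = r i powr s * a powr s"
      using ri nn by (simp add: powr_mult)
    also have "\<dots> \<le> 1 * (A * b)"
      using ab ri nn by (intro mult_mono) (auto simp: comparable_def)
    also have "\<dots> \<le> (?B * r' i) * (A * b)"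
      using 1 nn by (intro mult_right_mono) auto
    finally have le1: "(r i * a) powr s \<le> ?B * A * (r' i * b)"
      by (simp add: ac_simps)
    have "r' i * b \<le> 1 * (A * a powr s)"
      using ab ri' nn by (intro mult_mono) (auto simp: comparable_def)
    also have "\<dots> \<le> (?B * r i powr s) * (A * a powr s)"
      using 2 nn by (intro mult_right_mono) auto
    also have "\<dots> = ?B * A * (r i * a) powr s"
      using ri nn by (simp add: powr_mult)
    finally show ?thesis
      using le1 by (simp add: comparable_def)
  qed
  ultimately show thesis
    using that by blast
qed

text \<open>Write \<open>z = f i v\<close>. Then \<open>v\<close> is post-critical, and only the
  letter \<open>i\<close> in front has to be paid for.\<close>

lemma critical_comparable:
  obtains A where "0 < A"
    "\<And>i j z p. \<lbrakk>i \<in> {1..N}; j \<in> {1..N}; i \<noteq> j; z \<in> f i ` K; z \<in> f j ` K; p \<in> f i ` K\<rbrakk>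
      \<Longrightarrow> comparable s A (dist p z) (dist (h p) (h z))"
proof -
  obtain A where A: "0 < A"
    "\<And>v p. v \<in> F.P \<Longrightarrow> p \<in> K \<Longrightarrow> comparable s A (dist p v) (dist (h p) (h v))"
    using post_critical_comparable by blast
  obtain B where B: "1 \<le> B"
    "\<And>i A a b. \<lbrakk>i \<in> {1..N}; comparable s A a b; 0 \<le> A; 0 \<le> a; 0 \<le> b\<rbrakk>
      \<Longrightarrow> comparable s (B * A) (r i * a) (r' i * b)"
    using letter_comparable by blast
  have "comparable s (B * A) (dist p z) (dist (h p) (h z))"
    if *: "i \<in> {1..N}" "j \<in> {1..N}" "i \<noteq> j" "z \<in> f i ` K" "z \<in> f j ` K" "p \<in> f i ` K" for i j z p
  proof -
    obtain v where v: "v \<in> K" "z = f i v"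
      using *(4) by blast
    obtain q where q: "q \<in> K" "p = f i q"
      using *(6) by blast
    obtain u where u: "u \<in> K" "z = f j u"
      using *(5) by blast
    have "v \<in> F.P"
      using F.post_critical_of_critical[OF *(1-3) u(1) v(1)] u v by simp
    then have "comparable s (B * A) (r i * dist q v) (r' i * dist (h q) (h v))"
      using A(1) q(1) by (intro B(2)[OF *(1)] A(2)) (simp_all only: less_imp_le zero_le_dist)
    then show ?thesis
      using v q by (simp only: F.dist_map[OF *(1)] G.dist_map[OF *(1)] conj[OF *(1)])
  qed
  moreover have "0 < B * A"
    using A(1) B(1) by simp
  ultimately show thesis
    using that by blast
qed

text \<open>The level-one estimate behind all others. For disjoint pieces the distances are bounded
  above and below; for touching pieces the ASC reduces the claim to the distances from the common
  point \<open>z\<close>.\<close>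

lemma piece_comparable:
  obtains A where "0 < A"
    "\<And>i p q. \<lbrakk>i \<in> {1..N}; p \<in> f i ` K; q \<in> K; q \<notin> f i ` K\<rbrakk>
      \<Longrightarrow> comparable s A (dist p q) (dist (h p) (h q))"
proof -
  obtain c where c: "F.separating c"
    by (rule F.separating_exists)
  obtain c' where c': "G.separating c'"
    by (rule G.separating_exists)
  obtain D where D: "0 < D" "\<And>p q. p \<in> K \<Longrightarrow> q \<in> K \<Longrightarrow> dist p q \<le> D"
    using F.diameter_bound by blast
  obtain D' where D': "0 < D'" "\<And>p q. p \<in> K' \<Longrightarrow> q \<in> K' \<Longrightarrow> dist p q \<le> D'"
    using G.diameter_bound by blast
  obtain A where A: "0 < A"
    "\<And>i j z p. \<lbrakk>i \<in> {1..N}; j \<in> {1..N}; i \<noteq> j; z \<in> f i ` K; z \<in> f j ` K; p \<in> f i ` K\<rbrakk>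
      \<Longrightarrow> comparable s A (dist p z) (dist (h p) (h z))"
    using critical_comparable by blast
  define A1 where "A1 = D powr s / c' + D' / c powr s"
  define A2 where "A2 = 2 powr s * A / c' + 2 * A / c powr s"
  have pos: "0 < A1" "0 < A2"
    using F.separating_pos[OF c] G.separating_pos[OF c'] D(1) D'(1) A(1)
    by (simp_all add: A1_def A2_def add_pos_pos)
  have "comparable s (A1 + A2) (dist p q) (dist (h p) (h q))"
    if i: "i \<in> {1..N}" and pq: "p \<in> f i ` K" "q \<in> K" "q \<notin> f i ` K" for i p q
  proof -
    obtain j where j: "j \<in> {1..N}" "q \<in> f j ` K"
      using F.in_K_cases[OF pq(2)] by blast
    have ij: "i \<noteq> j"
      using j pq by blast
    have pK: "p \<in> K"
      using pq(1) F.map_in_K[OF i] by blast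
    have h: "h p \<in> g i ` K'" "h q \<in> g j ` K'"
      using h_mem_image_iff[OF i pK] h_mem_image_iff[OF j(1) pq(2)] pq(1) j(2) by simp_all
    show ?thesis
    proof (cases "f i ` K \<inter> f j ` K = {}")
      case True
      have "comparable s A1 (dist p q) (dist (h p) (h q))"
        unfolding A1_def
      proof (rule comparable_bounded[OF F.separating_pos[OF c] _ _ G.separating_pos[OF c'] _ _ s_pos])
        show "c \<le> dist p q" by (rule F.separating_gap[OF c i j(1) True pq(1) j(2)])
        show "dist p q \<le> D" by (rule D(2)[OF pK pq(2)])
        show "c' \<le> dist (h p) (h q)" by (rule G.separating_gap[OF c' i j(1) h_image_disjoint[OF i j(1) True] h])
        show "dist (h p) (h q) \<le> D'" by (rule D'(2)[OF h_in_K[OF pK] h_in_K[OF pq(2)]])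
      qed
      then show ?thesis
        using pos by (intro comparable_mono[where B = "A1 + A2"]) auto
    next
      case False
      then obtain z where z: "z \<in> f i ` K" "z \<in> f j ` K"
        by blast
      have zK: "z \<in> K"
        using z(1) F.map_in_K[OF i] by blast
      have hz: "h z \<in> g i ` K'" "h z \<in> g j ` K'"
        using h_mem_image_iff[OF i zK] h_mem_image_iff[OF j(1) zK] z by simp_all
      have "comparable s A2 (dist p q) (dist (h p) (h q))"
        unfolding A2_def
      proof (rule comparable_angle[OF _ _ A(1) s_pos])
        show "comparable s A (dist p z) (dist (h p) (h z))"
          by (rule A(2)[OF i j(1) ij z pq(1)])
        show "comparable s A (dist q z) (dist (h q) (h z))"
          by (rule A(2)[OF j(1) i ij[symmetric] z(2,1) j(2)])
        show "dist p q \<le> dist p z + dist q z" "dist (h p) (h q) \<le> dist (h p) (h z) + dist (h q) (h z)"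
          by (rule dist_triangle2)+
        show "c * dist p z \<le> dist p q" "c * dist q z \<le> dist p q"
          using F.separating_angle[OF c i j(1) ij z pq(1) j(2)] by simp_all
        show "c' * dist (h p) (h z) \<le> dist (h p) (h q)" "c' * dist (h q) (h z) \<le> dist (h p) (h q)"
          using G.separating_angle[OF c' i j(1) ij hz h] by simp_all
      qed (simp_all add: F.separating_pos[OF c] G.separating_pos[OF c'])
      then show ?thesis
        using pos by (intro comparable_mono[where B = "A1 + A2"]) auto
    qed
  qed
  moreover have "0 < A1 + A2"
    using pos by simp
  ultimately show thesis
    using that by blast
qed

text \<open>The letters of a cylinder containing \<open>p\<close> are boundary letters, apart from the first one, as
  long as the cylinder contains the point where the pieces of \<open>p\<close> and \<open>q\<close> meet.\<close>

lemma cylinder_split: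
  obtains B c where "0 < B" "0 < c"
    "\<And>\<tau> p q. \<lbrakk>\<tau> \<in> lists {1..N}; p \<in> K; q \<in> K; \<tau> \<noteq> [] \<Longrightarrow> q \<notin> f (hd \<tau>) ` K\<rbrakk> \<Longrightarrow>
      \<exists>\<tau>\<^sub>1 \<tau>\<^sub>2. \<tau> = \<tau>\<^sub>1 @ \<tau>\<^sub>2 \<and> comparable s B (word_ratio r \<tau>\<^sub>1) (word_ratio r' \<tau>\<^sub>1) \<and>
        (\<tau>\<^sub>2 = [] \<or> c * word_ratio r \<tau>\<^sub>1 \<le> dist (word_map f \<tau> p) q)"
proof -
  obtain c where sep: "F.separating c"
    by (rule F.separating_exists)
  have c: "0 < c" "c \<le> 1"
    by (rule F.separating_pos[OF sep], rule F.separating_le_1[OF sep])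
  obtain B where B: "1 \<le> B"
    "\<And>i A a b. \<lbrakk>i \<in> {1..N}; comparable s A a b; 0 \<le> A; 0 \<le> a; 0 \<le> b\<rbrakk>
      \<Longrightarrow> comparable s (B * A) (r i * a) (r' i * b)"
    using letter_comparable by blast
  have empty: "comparable s B 1 1"
    using B(1) by (simp add: comparable_def)
  \<comment> \<open>The factor \<open>c * c\<close> combines the gap between a piece and a
    post-critical point with the angle bound at \<open>z\<close>, which passes from the distance to
    \<open>z\<close> to the distance to \<open>q\<close>.\<close>
  have "\<exists>\<tau>\<^sub>1 \<tau>\<^sub>2. \<tau> = \<tau>\<^sub>1 @ \<tau>\<^sub>2 \<and> comparable s B (word_ratio r \<tau>\<^sub>1) (word_ratio r' \<tau>\<^sub>1) \<and>
        (\<tau>\<^sub>2 = [] \<or> c * c * word_ratio r \<tau>\<^sub>1 \<le> dist (word_map f \<tau> p) q)"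
    if \<tau>: "\<tau> \<in> lists {1..N}" and pq: "p \<in> K" "q \<in> K"
      and q: "\<tau> \<noteq> [] \<Longrightarrow> q \<notin> f (hd \<tau>) ` K" for \<tau> p q
  proof (cases \<tau>)
    case Nil
    then show ?thesis
      using empty by (intro exI[of _ "[]"]) simp
  next
    case (Cons i \<sigma>)
    have i: "i \<in> {1..N}" and \<sigma>: "\<sigma> \<in> lists {1..N}"
      using \<tau> Cons by simp_all
    have qi: "q \<notin> f i ` K"
      using q Cons by simp
    obtain j where j: "j \<in> {1..N}" "q \<in> f j ` K"
      using F.in_K_cases[OF pq(2)] by blast
    have ij: "i \<noteq> j"
      using j qi by blast
    have p_mem: "word_map f \<tau> p \<in> f i ` K"
      using F.word_map_hd_image[OF \<tau> _ pq(1)] Cons by simp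
    show ?thesis
    proof (cases "f i ` K \<inter> f j ` K = {}")
      case True
      \<comment> \<open>For disjoint pieces \<open>\<tau>\<^sub>1 = []\<close>, of ratio 1, is
        enough.\<close>
      have "c * c \<le> 1 * c"
        using c by (intro mult_right_mono) auto
      also have "1 * c \<le> dist (word_map f \<tau> p) q"
        using F.separating_gap[OF sep i j(1) True p_mem j(2)] by simp
      finally show ?thesis
        using empty by (intro exI[of _ "[]"] exI[of _ \<tau>]) simp
    next
      case False
      then obtain z where z: "z \<in> f i ` K" "z \<in> f j ` K"
        by blast
      obtain v where v: "v \<in> K" "z = f i v"
        using z(1) by blast
      obtain u where u: "u \<in> K" "z = f j u"
        using z(2) by blast
      have "v \<in> F.P"
        using F.post_critical_of_critical[OF i j(1) ij u(1) v(1)] u v by simp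
      then obtain \<sigma>\<^sub>1 \<sigma>\<^sub>2 u where \<sigma>\<^sub>1\<^sub>2: "\<sigma> = \<sigma>\<^sub>1 @ \<sigma>\<^sub>2" "set \<sigma>\<^sub>1 \<subseteq> boundary_letters N f K" "u \<in> F.P"
        "v = word_map f \<sigma>\<^sub>1 u" "\<sigma>\<^sub>2 = [] \<or> u \<notin> f (hd \<sigma>\<^sub>2) ` K"
        using F.post_critical_prefix[OF _ \<sigma>] by metis
      have lists: "\<sigma>\<^sub>1 \<in> lists {1..N}" "\<sigma>\<^sub>2 \<in> lists {1..N}"
        using \<sigma> \<sigma>\<^sub>1\<^sub>2(1) by simp_all
      have "comparable s 1 (word_ratio r \<sigma>\<^sub>1) (word_ratio r' \<sigma>\<^sub>1)"
        using word_ratio_boundary[OF lists(1) \<sigma>\<^sub>1\<^sub>2(2)] by (simp add: comparable_def)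
      then have "comparable s (B * 1) (word_ratio r (i # \<sigma>\<^sub>1)) (word_ratio r' (i # \<sigma>\<^sub>1))"
        using B(2)[OF i, of 1 "word_ratio r \<sigma>\<^sub>1" "word_ratio r' \<sigma>\<^sub>1"]
          F.word_ratio_pos[OF lists(1)] G.word_ratio_pos[OF lists(1)] by simp
      moreover have "\<sigma>\<^sub>2 = [] \<or> c * c * word_ratio r (i # \<sigma>\<^sub>1) \<le> dist (word_map f \<tau> p) q"
      proof (cases "\<sigma>\<^sub>2 = []")
        case ne: False
        have hd: "hd \<sigma>\<^sub>2 \<in> {1..N}"
          using lists(2) ne by (cases \<sigma>\<^sub>2) simp_all
        have eq: "word_map f \<tau> p = word_map f (i # \<sigma>\<^sub>1) (word_map f \<sigma>\<^sub>2 p)" "z = word_map f (i # \<sigma>\<^sub>1) u"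
          using Cons \<sigma>\<^sub>1\<^sub>2 v by (simp_all add: word_map_append)
        have l: "i # \<sigma>\<^sub>1 \<in> lists {1..N}"
          using i lists by simp
        have "c \<le> dist (word_map f \<sigma>\<^sub>2 p) u"
          using \<sigma>\<^sub>1\<^sub>2(5) ne by (intro F.separating_vertex[OF sep hd \<sigma>\<^sub>1\<^sub>2(3)] F.word_map_hd_image lists pq) simp_all
        then have "word_ratio r (i # \<sigma>\<^sub>1) * c \<le> dist (word_map f \<tau> p) z"
          unfolding eq F.dist_word_map[OF l] using F.word_ratio_pos[OF l]
          by (intro mult_left_mono) simp_all
        then have "c * (word_ratio r (i # \<sigma>\<^sub>1) * c) \<le> c * dist (word_map f \<tau> p) z"
          using c by (intro mult_left_mono) simp_all
        also have "\<dots> \<le> dist (word_map f \<tau> p) q"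
          using F.separating_angle[OF sep i j(1) ij z p_mem j(2)] by simp
        finally show ?thesis
          by (simp add: ac_simps)
      qed simp
      ultimately show ?thesis
        using Cons \<sigma>\<^sub>1\<^sub>2(1) by (intro exI[of _ "i # \<sigma>\<^sub>1"] exI[of _ \<sigma>\<^sub>2]) simp
    qed
  qed
  moreover have "0 < B" "0 < c * c"
    using B(1) c(1) by simp_all
  ultimately show thesis
    using that[of B "c * c"] by blast
qed

end

section \<open>The quasisymmetric control function\<close>

text \<open>The smaller exponent dominates for \<open>t \<le> 1\<close>, the larger one for
  \<open>t > 1\<close>.\<close>

lemma powr_le_powr_add:
  fixes t :: real
  assumes "0 \<le> t" "a \<le> s" "s \<le> b"
  shows "t powr s \<le> t powr a + t powr b"
proof (cases "t \<le> 1")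
  case True
  have "t powr s \<le> t powr a"
    using assms True by (intro powr_mono') auto
  then show ?thesis by (simp add: add_increasing2)
next
  case False
  have "t powr s \<le> t powr b"
    using assms False by (intro powr_mono) auto
  then show ?thesis by (simp add: add_increasing)
qed

lemma homeomorphism_powr_sum:
  assumes C: "0 < C" and ab: "0 < a" "0 < b"
  defines "\<eta> \<equiv> \<lambda>t::real. C * (t powr a + t powr b)"
  shows "strict_mono_on {0..} \<eta>" "\<exists>\<eta>'. homeomorphism {0..} {0..} \<eta> \<eta>'"
proof -
  show mono: "strict_mono_on {0..} \<eta>"
    unfolding \<eta>_def using assms
    by (intro strict_mono_onI mult_strict_left_mono add_strict_mono powr_less_mono2) auto
  have cont: "continuous_on {0..} \<eta>"
    unfolding \<eta>_def using ab by (intro continuous_intros continuous_on_powr') auto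
  have "\<eta> ` {0..} = {0..}"
  proof (intro set_eqI iffI)
    fix y assume "y \<in> \<eta> ` {0..}"
    then show "y \<in> {0..}"
      using C by (auto simp: \<eta>_def)
  next
    fix y :: real assume y: "y \<in> {0..}"
    \<comment> \<open>At \<open>T\<close> the term with exponent \<open>a\<close> alone reaches
      \<open>y\<close>, so the intermediate value theorem applies between 0 and
      \<open>T\<close>.\<close>
    define T where "T = (y / C) powr (1 / a)"
    have "y = C * T powr a"
      using y C ab by (simp add: T_def powr_powr)
    also have "\<dots> \<le> \<eta> T"
      using C by (simp add: \<eta>_def)
    finally have "\<exists>x\<ge>0. x \<le> T \<and> \<eta> x = y"
      using y ab by (intro IVT' continuous_on_subset[OF cont]) (auto simp: \<eta>_def T_def)
    then show "y \<in> \<eta> ` {0..}"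
      by auto
  qed
  moreover have "path_connected {0::real..}"
    by (intro convex_imp_path_connected) simp
  ultimately show "\<exists>\<eta>'. homeomorphism {0..} {0..} \<eta> \<eta>'"
    using cont strict_mono_on_imp_inj_on[OF mono] by (intro homeomorphism_into_1d)
qed

text \<open>For a word of ratio \<open>\<rho>\<^sub>1 * \<rho>\<^sub>2\<close> the exponent
  \<open>s\<close> is available up to \<open>B\<close> on the first part, but only \<open>a\<close>
  on the second. The left-over power \<open>s - a\<close> of
  \<open>\<rho>\<^sub>1 * e\<^sub>1\<close> is absorbed because
  \<open>\<rho>\<^sub>1 * e\<^sub>1 \<le> (D / c) * e\<^sub>2\<close>; it does not occur when the
  second part is trivial.\<close>

lemma snowflake_ratio_upper:
  fixes \<rho>\<^sub>1 :: real
  assumes pos: "0 < \<rho>\<^sub>1" "0 < \<rho>\<^sub>2" "0 \<le> \<rho>\<^sub>2'" "0 \<le> e\<^sub>1" "e\<^sub>1 \<le> D" "0 \<le> e\<^sub>2" "0 \<le> t" "0 < B" "0 < c"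
    and exps: "0 < a" "a \<le> s" "s \<le> b"
    and ratios: "\<rho>\<^sub>1' \<le> B * \<rho>\<^sub>1 powr s" "\<rho>\<^sub>2' \<le> \<rho>\<^sub>2 powr a"
    and split: "\<rho>\<^sub>2 = 1 \<and> \<rho>\<^sub>2' = 1 \<or> c * \<rho>\<^sub>1 \<le> e\<^sub>2"
    and le: "\<rho>\<^sub>1 * \<rho>\<^sub>2 * e\<^sub>1 \<le> t * e\<^sub>2"
  shows "\<rho>\<^sub>1' * \<rho>\<^sub>2' * e\<^sub>1 powr s \<le> B * (1 + (D / c) powr (s - a)) * (t powr a + t powr b) * e\<^sub>2 powr s"
proof -
  let ?T = "t powr a + t powr b" and ?E = "(D / c) powr (s - a)"
  have T: "0 \<le> ?T" "t powr a \<le> ?T" "t powr s \<le> ?T"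
    using powr_le_powr_add[of t a s b] exps pos by auto
  have E: "0 \<le> ?E" by simp
  have "\<rho>\<^sub>1 powr s * \<rho>\<^sub>2' * e\<^sub>1 powr s \<le> (1 + ?E) * ?T * e\<^sub>2 powr s"
    using split
  proof
    assume 1: "\<rho>\<^sub>2 = 1 \<and> \<rho>\<^sub>2' = 1"
    have "\<rho>\<^sub>1 powr s * \<rho>\<^sub>2' * e\<^sub>1 powr s = (\<rho>\<^sub>1 * \<rho>\<^sub>2 * e\<^sub>1) powr s"
      using 1 pos by (simp add: powr_mult)
    also have "\<dots> \<le> (t * e\<^sub>2) powr s"
      using le pos exps by (intro powr_mono2) auto
    also have "\<dots> = 1 * t powr s * e\<^sub>2 powr s"
      using pos by (simp add: powr_mult)
    also have "\<dots> \<le> (1 + ?E) * ?T * e\<^sub>2 powr s"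
      using T E by (intro mult_right_mono mult_mono) auto
    finally show ?thesis .
  next
    assume c: "c * \<rho>\<^sub>1 \<le> e\<^sub>2"
    have "\<rho>\<^sub>1 powr s * \<rho>\<^sub>2' * e\<^sub>1 powr s \<le> \<rho>\<^sub>1 powr s * \<rho>\<^sub>2 powr a * e\<^sub>1 powr s"
      using ratios by (intro mult_right_mono mult_left_mono) auto
    also have "\<dots> = (\<rho>\<^sub>1 powr a * \<rho>\<^sub>1 powr (s - a)) * \<rho>\<^sub>2 powr a * (e\<^sub>1 powr a * e\<^sub>1 powr (s - a))"
      by (simp flip: powr_add)
    also have "\<dots> = (\<rho>\<^sub>1 * \<rho>\<^sub>2 * e\<^sub>1) powr a * (\<rho>\<^sub>1 * e\<^sub>1) powr (s - a)"
      using pos by (simp add: powr_mult)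
    also have "\<dots> \<le> (t * e\<^sub>2) powr a * (e\<^sub>2 * (D / c)) powr (s - a)"
    proof (rule mult_mono)
      show "(\<rho>\<^sub>1 * \<rho>\<^sub>2 * e\<^sub>1) powr a \<le> (t * e\<^sub>2) powr a"
        using le exps pos by (intro powr_mono2) auto
      have "\<rho>\<^sub>1 * e\<^sub>1 \<le> (e\<^sub>2 / c) * D"
        using c pos by (intro mult_mono) (auto simp: field_simps)
      then show "(\<rho>\<^sub>1 * e\<^sub>1) powr (s - a) \<le> (e\<^sub>2 * (D / c)) powr (s - a)"
        using exps pos by (intro powr_mono2) auto
    qed auto
    also have "\<dots> = ?E * t powr a * (e\<^sub>2 powr a * e\<^sub>2 powr (s - a))"
      using pos by (simp add: powr_mult powr_divide)
    also have "e\<^sub>2 powr a * e\<^sub>2 powr (s - a) = e\<^sub>2 powr s"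
      by (simp flip: powr_add)
    also have "?E * t powr a * e\<^sub>2 powr s \<le> (1 + ?E) * ?T * e\<^sub>2 powr s"
      using T E by (intro mult_right_mono mult_mono) auto
    finally show ?thesis .
  qed
  then have "B * (\<rho>\<^sub>1 powr s * \<rho>\<^sub>2' * e\<^sub>1 powr s) \<le> B * ((1 + ?E) * ?T * e\<^sub>2 powr s)"
    using pos by (intro mult_left_mono) auto
  moreover have "\<rho>\<^sub>1' * (\<rho>\<^sub>2' * e\<^sub>1 powr s) \<le> B * \<rho>\<^sub>1 powr s * (\<rho>\<^sub>2' * e\<^sub>1 powr s)"
    using ratios pos by (intro mult_right_mono) auto
  ultimately show ?thesis
    by (simp add: mult.assoc)
qed

text \<open>The counterpart with the word on the right-hand side: the second part is now bounded
  below with exponent \<open>b\<close>, and the excess \<open>b - s\<close> is absorbed through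
  \<open>e\<^sub>1 \<ge> c * \<rho>\<^sub>1\<close> and \<open>e\<^sub>2 \<le> D\<close>.\<close>

lemma snowflake_ratio_lower:
  fixes \<rho>\<^sub>1 :: real
  assumes pos: "0 < \<rho>\<^sub>1" "0 < \<rho>\<^sub>2" "0 \<le> \<rho>\<^sub>2'" "0 \<le> e\<^sub>1" "0 \<le> e\<^sub>2" "e\<^sub>2 \<le> D" "0 \<le> t" "0 < B" "0 < c"
    and exps: "0 < a" "a \<le> s" "s \<le> b"
    and ratios: "\<rho>\<^sub>1 powr s \<le> B * \<rho>\<^sub>1'" "\<rho>\<^sub>2 powr b \<le> \<rho>\<^sub>2'"
    and split: "\<rho>\<^sub>2 = 1 \<and> \<rho>\<^sub>2' = 1 \<or> c * \<rho>\<^sub>1 \<le> e\<^sub>1"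
    and le: "e\<^sub>1 \<le> t * (\<rho>\<^sub>1 * \<rho>\<^sub>2 * e\<^sub>2)"
  shows "e\<^sub>1 powr s \<le> B * (1 + (D / c) powr (b - s)) * (t powr a + t powr b) * (\<rho>\<^sub>1' * \<rho>\<^sub>2' * e\<^sub>2 powr s)"
proof -
  let ?T = "t powr a + t powr b" and ?E = "(D / c) powr (b - s)"
  have T: "0 \<le> ?T" "t powr b \<le> ?T" "t powr s \<le> ?T"
    using powr_le_powr_add[of t a s b] exps pos by auto
  have E: "0 \<le> ?E" by simp
  have "e\<^sub>1 powr s \<le> (1 + ?E) * ?T * (\<rho>\<^sub>1 powr s * \<rho>\<^sub>2' * e\<^sub>2 powr s)"
    using split
  proof
    assume 1: "\<rho>\<^sub>2 = 1 \<and> \<rho>\<^sub>2' = 1"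
    have "e\<^sub>1 powr s \<le> (t * (\<rho>\<^sub>1 * \<rho>\<^sub>2 * e\<^sub>2)) powr s"
      using le pos exps by (intro powr_mono2) auto
    also have "\<dots> = 1 * t powr s * (\<rho>\<^sub>1 powr s * \<rho>\<^sub>2' * e\<^sub>2 powr s)"
      using 1 pos by (simp add: powr_mult)
    also have "\<dots> \<le> (1 + ?E) * ?T * (\<rho>\<^sub>1 powr s * \<rho>\<^sub>2' * e\<^sub>2 powr s)"
      using T E pos by (intro mult_right_mono mult_mono) auto
    finally show ?thesis .
  next
    assume c: "c * \<rho>\<^sub>1 \<le> e\<^sub>1"
    have c\<rho>: "0 < c * \<rho>\<^sub>1"
      using pos by simp
    have e\<^sub>2: "e\<^sub>2 powr b \<le> D powr (b - s) * e\<^sub>2 powr s"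
    proof -
      have "e\<^sub>2 powr b = e\<^sub>2 powr (b - s) * e\<^sub>2 powr s"
        by (simp flip: powr_add)
      also have "\<dots> \<le> D powr (b - s) * e\<^sub>2 powr s"
        using pos exps by (intro mult_right_mono powr_mono2) auto
      finally show ?thesis .
    qed
    \<comment> \<open>Since \<open>s - b \<le> 0\<close>, the lower bound on
      \<open>e\<^sub>1\<close> becomes an upper bound for the first factor.\<close>
    have "e\<^sub>1 powr s = e\<^sub>1 powr (s - b) * e\<^sub>1 powr b"
      by (simp flip: powr_add)
    also have "\<dots> \<le> (c * \<rho>\<^sub>1) powr (s - b) * (t * (\<rho>\<^sub>1 * \<rho>\<^sub>2 * e\<^sub>2)) powr b"
      using c c\<rho> le pos exps by (intro mult_mono powr_mono2' powr_mono2) auto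
    also have "\<dots> = c powr (s - b) * t powr b * (\<rho>\<^sub>1 powr (s - b) * \<rho>\<^sub>1 powr b) * \<rho>\<^sub>2 powr b * e\<^sub>2 powr b"
      using pos by (simp add: powr_mult)
    also have "\<rho>\<^sub>1 powr (s - b) * \<rho>\<^sub>1 powr b = \<rho>\<^sub>1 powr s"
      by (simp flip: powr_add)
    also have "c powr (s - b) * t powr b * \<rho>\<^sub>1 powr s * \<rho>\<^sub>2 powr b * e\<^sub>2 powr b
      \<le> c powr (s - b) * t powr b * \<rho>\<^sub>1 powr s * \<rho>\<^sub>2' * (D powr (b - s) * e\<^sub>2 powr s)"
      using ratios e\<^sub>2 pos by (intro mult_mono) auto
    also have "\<dots> = (c powr (s - b) * D powr (b - s)) * t powr b * (\<rho>\<^sub>1 powr s * \<rho>\<^sub>2' * e\<^sub>2 powr s)"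
      by (simp only: ac_simps)
    also have "c powr (s - b) * D powr (b - s) = ?E"
      using pos powr_minus_divide[of c "b - s"] by (simp add: powr_divide)
    also have "?E * t powr b * (\<rho>\<^sub>1 powr s * \<rho>\<^sub>2' * e\<^sub>2 powr s) \<le> (1 + ?E) * ?T * (\<rho>\<^sub>1 powr s * \<rho>\<^sub>2' * e\<^sub>2 powr s)"
      using T E pos by (intro mult_right_mono mult_mono) auto
    finally show ?thesis .
  qed
  also have "\<dots> \<le> (1 + ?E) * ?T * (B * \<rho>\<^sub>1' * \<rho>\<^sub>2' * e\<^sub>2 powr s)"
    using ratios T E pos by (intro mult_left_mono mult_right_mono) auto
  finally show ?thesis
    by (simp add: ac_simps)
qed

section \<open>Three-point estimates along a coding\<close>

context ifs_conjugacy
begin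

text \<open>Each letter has its own exponent \<open>e i > 0\<close> with
  \<open>r' i = r i powr e i\<close>. Take \<open>a\<close> and \<open>b\<close> to be the extreme
  exponents, with \<open>s\<close> thrown in; multiplicativity extends the bounds to words.\<close>

lemma word_ratio_exponents:
  obtains a b where "0 < a" "a \<le> s" "s \<le> b"
    "\<And>\<omega>. \<omega> \<in> lists {1..N} \<Longrightarrow> word_ratio r' \<omega> \<le> word_ratio r \<omega> powr a"
    "\<And>\<omega>. \<omega> \<in> lists {1..N} \<Longrightarrow> word_ratio r \<omega> powr b \<le> word_ratio r' \<omega>"
proof -
  define e where "e i = ln (r' i) / ln (r i)" for i
  define a where "a = Min (insert s (e ` {1..N}))"
  define b where "b = Max (insert s (e ` {1..N}))"
  have e_pos: "0 < e i" and r'_eq: "r' i = r i powr e i" if i: "i \<in> {1..N}" for i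
  proof -
    have "0 < r i" "ln (r i) < 0" "0 < r' i" "ln (r' i) < 0"
      using F.ratio_pos[OF i] F.ratio_less_1[OF i] G.ratio_pos[OF i] G.ratio_less_1[OF i] by auto
    then show "0 < e i" "r' i = r i powr e i"
      by (auto simp: e_def divide_neg_neg powr_def)
  qed
  have letter: "r' i \<le> r i powr a" "r i powr b \<le> r' i" if i: "i \<in> {1..N}" for i
  proof -
    have "a \<le> e i" "e i \<le> b"
      unfolding a_def b_def using i by (intro Min_le Max_ge; blast)+
    then show "r' i \<le> r i powr a" "r i powr b \<le> r' i"
      unfolding r'_eq[OF i] using F.ratio_pos[OF i] F.ratio_less_1[OF i]
      by (auto intro: powr_mono')
  qed
  have word: "word_ratio r' \<omega> \<le> word_ratio r \<omega> powr a \<and> word_ratio r \<omega> powr b \<le> word_ratio r' \<omega>"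
    if "\<omega> \<in> lists {1..N}" for \<omega>
    using that
  proof (induction \<omega> rule: lists.induct)
    case (Cons i \<omega>)
    note pos = F.ratio_pos[OF Cons(1)] G.ratio_pos[OF Cons(1)] F.word_ratio_pos[OF Cons(2)]
      G.word_ratio_pos[OF Cons(2)]
    have "r' i * word_ratio r' \<omega> \<le> r i powr a * word_ratio r \<omega> powr a"
      "r i powr b * word_ratio r \<omega> powr b \<le> r' i * word_ratio r' \<omega>"
      using Cons.IH letter[OF Cons(1)] pos by (auto intro!: mult_mono)
    then show ?case
      using pos by (simp add: powr_mult)
  qed simp
  have "0 < a"
    unfolding a_def using s_pos e_pos by (subst Min_gr_iff) auto
  moreover have "a \<le> s" "s \<le> b"
    by (auto simp: a_def b_def)
  ultimately show thesis
    using that word by blast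
qed

text \<open>For the three-point estimate when \<open>z\<close> leaves the coding of \<open>x\<close>
  no later than \<open>y\<close>: \<tau> is the stretch of the coding between the two levels,
  \<open>q\<close> the rescaled \<open>z\<close>, and \<open>e\<close> the rescaled distance from
  \<open>x\<close> to \<open>y\<close>.\<close>

lemma cylinder_far:
  assumes exps: "0 < a" "a \<le> s" "s \<le> b"
    and upper: "\<And>\<omega>. \<omega> \<in> lists {1..N} \<Longrightarrow> word_ratio r' \<omega> \<le> word_ratio r \<omega> powr a"
    and D: "0 < D"
  obtains C where "0 < C"
    "\<And>\<tau> p q e t. \<lbrakk>\<tau> \<in> lists {1..N}; p \<in> K; q \<in> K; \<tau> \<noteq> [] \<Longrightarrow> q \<notin> f (hd \<tau>) ` K; 0 \<le> e; e \<le> D; 0 \<le> t;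
      word_ratio r \<tau> * e \<le> t * dist (word_map f \<tau> p) q\<rbrakk> \<Longrightarrow>
      word_ratio r' \<tau> * e powr s \<le> C * (t powr a + t powr b) * dist (word_map f \<tau> p) q powr s"
proof -
  obtain B c where Bc: "0 < B" "0 < c"
    and split: "\<And>\<tau> p q. \<lbrakk>\<tau> \<in> lists {1..N}; p \<in> K; q \<in> K; \<tau> \<noteq> [] \<Longrightarrow> q \<notin> f (hd \<tau>) ` K\<rbrakk> \<Longrightarrow>
      \<exists>\<tau>\<^sub>1 \<tau>\<^sub>2. \<tau> = \<tau>\<^sub>1 @ \<tau>\<^sub>2 \<and> comparable s B (word_ratio r \<tau>\<^sub>1) (word_ratio r' \<tau>\<^sub>1) \<and>
        (\<tau>\<^sub>2 = [] \<or> c * word_ratio r \<tau>\<^sub>1 \<le> dist (word_map f \<tau> p) q)"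
    using cylinder_split by blast
  show thesis
  proof
    show "0 < B * (1 + (D / c) powr (s - a))"
      using Bc by (simp add: add_pos_nonneg)
  next
    fix \<tau> p q and e t :: real
    assume \<tau>: "\<tau> \<in> lists {1..N}" and pq: "p \<in> K" "q \<in> K" "\<tau> \<noteq> [] \<Longrightarrow> q \<notin> f (hd \<tau>) ` K"
      and et: "0 \<le> e" "e \<le> D" "0 \<le> t" and le: "word_ratio r \<tau> * e \<le> t * dist (word_map f \<tau> p) q"
    obtain \<tau>\<^sub>1 \<tau>\<^sub>2 where *: "\<tau> = \<tau>\<^sub>1 @ \<tau>\<^sub>2" "comparable s B (word_ratio r \<tau>\<^sub>1) (word_ratio r' \<tau>\<^sub>1)"
      "\<tau>\<^sub>2 = [] \<or> c * word_ratio r \<tau>\<^sub>1 \<le> dist (word_map f \<tau> p) q"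
      using split[OF \<tau> pq] by blast
    have lists: "\<tau>\<^sub>1 \<in> lists {1..N}" "\<tau>\<^sub>2 \<in> lists {1..N}"
      using \<tau> *(1) by simp_all
    have "word_ratio r' \<tau>\<^sub>1 * word_ratio r' \<tau>\<^sub>2 * e powr s \<le>
      B * (1 + (D / c) powr (s - a)) * (t powr a + t powr b) * dist (word_map f \<tau> p) q powr s"
    proof (rule snowflake_ratio_upper[OF _ _ _ et(1,2) zero_le_dist et(3) Bc exps])
      show "word_ratio r' \<tau>\<^sub>1 \<le> B * word_ratio r \<tau>\<^sub>1 powr s"
        using *(2) by (simp only: comparable_def)
      show "word_ratio r' \<tau>\<^sub>2 \<le> word_ratio r \<tau>\<^sub>2 powr a"
        by (rule upper[OF lists(2)])
      show "word_ratio r \<tau>\<^sub>2 = 1 \<and> word_ratio r' \<tau>\<^sub>2 = 1 \<or> c * word_ratio r \<tau>\<^sub>1 \<le> dist (word_map f \<tau> p) q"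
        using *(3) by auto
      show "word_ratio r \<tau>\<^sub>1 * word_ratio r \<tau>\<^sub>2 * e \<le> t * dist (word_map f \<tau> p) q"
        using le *(1) by simp
    qed (intro F.word_ratio_pos less_imp_le[OF G.word_ratio_pos] lists)+
    then show "word_ratio r' \<tau> * e powr s \<le>
      B * (1 + (D / c) powr (s - a)) * (t powr a + t powr b) * dist (word_map f \<tau> p) q powr s"
      using *(1) by simp
  qed
qed

text \<open>The same with \<open>y\<close> leaving first: \<open>q\<close> is the rescaled
  \<open>y\<close> and \<open>e\<close> the rescaled distance from \<open>x\<close> to
  \<open>z\<close>.\<close>

lemma cylinder_near:
  assumes exps: "0 < a" "a \<le> s" "s \<le> b"
    and lower: "\<And>\<omega>. \<omega> \<in> lists {1..N} \<Longrightarrow> word_ratio r \<omega> powr b \<le> word_ratio r' \<omega>"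
    and D: "0 < D"
  obtains C where "0 < C"
    "\<And>\<tau> p q e t. \<lbrakk>\<tau> \<in> lists {1..N}; p \<in> K; q \<in> K; \<tau> \<noteq> [] \<Longrightarrow> q \<notin> f (hd \<tau>) ` K; 0 \<le> e; e \<le> D; 0 \<le> t;
      dist (word_map f \<tau> p) q \<le> t * (word_ratio r \<tau> * e)\<rbrakk> \<Longrightarrow>
      dist (word_map f \<tau> p) q powr s \<le> C * (t powr a + t powr b) * (word_ratio r' \<tau> * e powr s)"
proof -
  obtain B c where Bc: "0 < B" "0 < c"
    and split: "\<And>\<tau> p q. \<lbrakk>\<tau> \<in> lists {1..N}; p \<in> K; q \<in> K; \<tau> \<noteq> [] \<Longrightarrow> q \<notin> f (hd \<tau>) ` K\<rbrakk> \<Longrightarrow>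
      \<exists>\<tau>\<^sub>1 \<tau>\<^sub>2. \<tau> = \<tau>\<^sub>1 @ \<tau>\<^sub>2 \<and> comparable s B (word_ratio r \<tau>\<^sub>1) (word_ratio r' \<tau>\<^sub>1) \<and>
        (\<tau>\<^sub>2 = [] \<or> c * word_ratio r \<tau>\<^sub>1 \<le> dist (word_map f \<tau> p) q)"
    using cylinder_split by blast
  show thesis
  proof
    show "0 < B * (1 + (D / c) powr (b - s))"
      using Bc by (simp add: add_pos_nonneg)
  next
    fix \<tau> p q and e t :: real
    assume \<tau>: "\<tau> \<in> lists {1..N}" and pq: "p \<in> K" "q \<in> K" "\<tau> \<noteq> [] \<Longrightarrow> q \<notin> f (hd \<tau>) ` K"
      and et: "0 \<le> e" "e \<le> D" "0 \<le> t" and le: "dist (word_map f \<tau> p) q \<le> t * (word_ratio r \<tau> * e)"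
    obtain \<tau>\<^sub>1 \<tau>\<^sub>2 where *: "\<tau> = \<tau>\<^sub>1 @ \<tau>\<^sub>2" "comparable s B (word_ratio r \<tau>\<^sub>1) (word_ratio r' \<tau>\<^sub>1)"
      "\<tau>\<^sub>2 = [] \<or> c * word_ratio r \<tau>\<^sub>1 \<le> dist (word_map f \<tau> p) q"
      using split[OF \<tau> pq] by blast
    have lists: "\<tau>\<^sub>1 \<in> lists {1..N}" "\<tau>\<^sub>2 \<in> lists {1..N}"
      using \<tau> *(1) by simp_all
    have "dist (word_map f \<tau> p) q powr s \<le>
      B * (1 + (D / c) powr (b - s)) * (t powr a + t powr b) * (word_ratio r' \<tau>\<^sub>1 * word_ratio r' \<tau>\<^sub>2 * e powr s)"
    proof (rule snowflake_ratio_lower[OF _ _ _ zero_le_dist et Bc exps])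
      show "word_ratio r \<tau>\<^sub>1 powr s \<le> B * word_ratio r' \<tau>\<^sub>1"
        using *(2) by (simp only: comparable_def)
      show "word_ratio r \<tau>\<^sub>2 powr b \<le> word_ratio r' \<tau>\<^sub>2"
        by (rule lower[OF lists(2)])
      show "word_ratio r \<tau>\<^sub>2 = 1 \<and> word_ratio r' \<tau>\<^sub>2 = 1 \<or> c * word_ratio r \<tau>\<^sub>1 \<le> dist (word_map f \<tau> p) q"
        using *(3) by auto
      show "dist (word_map f \<tau> p) q \<le> t * (word_ratio r \<tau>\<^sub>1 * word_ratio r \<tau>\<^sub>2 * e)"
        using le *(1) by simp
    qed (intro F.word_ratio_pos less_imp_le[OF G.word_ratio_pos] lists)+
    then show "dist (word_map f \<tau> p) q powr s \<le>
      B * (1 + (D / c) powr (b - s)) * (t powr a + t powr b) * (word_ratio r' \<tau> * e powr s)"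
      using *(1) by simp
  qed
qed

text \<open>\<open>q'\<close> plays the role of \<open>q\<close> rescaled by the cylinder of the
  first \<open>n\<close> letters. The later estimates use no more of this rescaling than the
  distance identities listed here.\<close>

definition separated_in_cylinder :: "real \<Rightarrow> (nat \<Rightarrow> nat) \<Rightarrow> 'a \<Rightarrow> nat \<Rightarrow> 'a \<Rightarrow> bool" where
  "separated_in_cylinder A w q n q' \<longleftrightarrow>
    q' \<in> K \<and> q' \<notin> f (w n) ` K \<and>
    comparable s A (dist (F.\<pi> (\<lambda>k. w (n + k))) q') (dist (h (F.\<pi> (\<lambda>k. w (n + k)))) (h q')) \<and>
    dist (F.\<pi> w) q = word_ratio r (map w [0..<n]) * dist (F.\<pi> (\<lambda>k. w (n + k))) q' \<and>
    dist (h (F.\<pi> w)) (h q) =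
      word_ratio r' (map w [0..<n]) * dist (h (F.\<pi> (\<lambda>k. w (n + k)))) (h q')"

text \<open>At the level of first separation the rescaled points fall under
  \<open>piece_comparable\<close>, and the common word map scales each metric exactly.\<close>

lemma snowflake_in_cylinder:
  obtains A where "0 < A"
    "\<And>w q. \<lbrakk>w \<in> infinite_words N; q \<in> K; q \<noteq> F.\<pi> w\<rbrakk> \<Longrightarrow> \<exists>n q'. separated_in_cylinder A w q n q'"
proof -
  obtain A where A: "0 < A"
    "\<And>i p q. \<lbrakk>i \<in> {1..N}; p \<in> f i ` K; q \<in> K; q \<notin> f i ` K\<rbrakk>
      \<Longrightarrow> comparable s A (dist p q) (dist (h p) (h q))"
    using piece_comparable by blast
  show thesis
  proof
    show "0 < A" by (rule A(1))
  next
    fix w q assume w: "w \<in> infinite_words N" and q: "q \<in> K" "q \<noteq> F.\<pi> w"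
    obtain n q' where n: "q' \<in> K" "q' \<notin> f (w n) ` K" "q = word_map f (map w [0..<n]) q'"
      using F.first_separation[OF w q] by blast
    let ?p = "F.\<pi> (\<lambda>k. w (n + k))"
    note shift = infinite_words_shift[OF w, of n]
    have p: "?p \<in> K" "F.\<pi> w = word_map f (map w [0..<n]) ?p"
      by (rule F.coding_map_in_K[OF shift], rule F.coding_map_shift[OF w])
    have "?p \<in> f (w n) ` K"
      using F.coding_map_in_cylinder[OF shift, of 1] by simp
    then have "comparable s A (dist ?p q') (dist (h ?p) (h q'))"
      by (rule A(2)[OF infinite_words_nth[OF w] _ n(1,2)])
    moreover have "dist (F.\<pi> w) q = word_ratio r (map w [0..<n]) * dist ?p q'"
      unfolding p(2) n(3) by (rule F.dist_word_map[OF map_upt_in_lists[OF w]])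
    moreover have "dist (h (F.\<pi> w)) (h q) = word_ratio r' (map w [0..<n]) * dist (h ?p) (h q')"
      unfolding p(2) n(3) by (rule dist_conjugate_word_map[OF map_upt_in_lists[OF w] p(1) n(1)])
    ultimately show "\<exists>n q'. separated_in_cylinder A w q n q'"
      unfolding separated_in_cylinder_def using n by (intro exI[of _ n] exI[of _ q'] conjI)
  qed
qed

text \<open>Every cylinder scales both metrics by the same factor, so the constant of level one is
  valid at all depths.\<close>

lemma lipschitz_equivalent_if_equal_ratios:
  assumes s: "s = 1" and r: "\<And>i. i \<in> {1..N} \<Longrightarrow> r i = r' i"
  shows "lipschitz_equivalent K K'"
proof -
  obtain A where A: "0 < A"
    and cyl: "\<And>w q. \<lbrakk>w \<in> infinite_words N; q \<in> K; q \<noteq> F.\<pi> w\<rbrakk> \<Longrightarrow> \<exists>n q'. separated_in_cylinder A w q n q'"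
    using snowflake_in_cylinder by blast
  have "dist p q / A \<le> dist (h p) (h q) \<and> dist (h p) (h q) \<le> A * dist p q"
    if p: "p \<in> K" and q: "q \<in> K" for p q
  proof (cases "q = p")
    case True
    then show ?thesis by simp
  next
    case False
    obtain w where w: "w \<in> infinite_words N" "F.\<pi> w = p"
      using F.coding_map_surj[OF p] by blast
    have "q \<noteq> F.\<pi> w"
      using False w(2) by simp
    then obtain n q' where *: "comparable s A (dist (F.\<pi> (\<lambda>k. w (n + k))) q') (dist (h (F.\<pi> (\<lambda>k. w (n + k)))) (h q'))"
      "dist p q = word_ratio r (map w [0..<n]) * dist (F.\<pi> (\<lambda>k. w (n + k))) q'"
      "dist (h p) (h q) = word_ratio r' (map w [0..<n]) * dist (h (F.\<pi> (\<lambda>k. w (n + k)))) (h q')"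
      using cyl[OF w(1) q] unfolding separated_in_cylinder_def w(2) by blast
    have "word_ratio r' (map w [0..<n]) = word_ratio r (map w [0..<n])"
      using r[OF infinite_words_nth[OF w(1)]] by (simp add: comp_def)
    moreover have "word_ratio r (map w [0..<n]) powr s = word_ratio r (map w [0..<n])"
      using s F.word_ratio_pos[OF map_upt_in_lists[OF w(1), of 0 n]] by (simp add: less_imp_le)
    ultimately have "comparable s A (dist p q) (dist (h p) (h q))"
      unfolding *(2,3) using F.word_ratio_pos[OF map_upt_in_lists[OF w(1), of 0 n]]
      by (intro comparable_scale[OF *(1)]) simp_all
    then show ?thesis
      using A s by (simp add: comparable_def field_simps)
  qed
  then show ?thesis
    unfolding lipschitz_equivalent_def using bij A by blast
qed

text \<open>\<open>h\<close> is Hoelder continuous with exponent \<open>a\<close>: the ratios of the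
  common cylinder satisfy the bound with exponent \<open>a\<close>, and \<open>a \<le> s\<close>
  with bounded diameter lowers the exponent of the rescaled distance from \<open>s\<close> to
  \<open>a\<close>.\<close>

lemma continuous_on_conjugacy: "continuous_on K h"
proof -
  obtain a b where exps: "0 < a" "a \<le> s" "s \<le> b"
    and upper: "\<And>\<omega>. \<omega> \<in> lists {1..N} \<Longrightarrow> word_ratio r' \<omega> \<le> word_ratio r \<omega> powr a"
    and lower: "\<And>\<omega>. \<omega> \<in> lists {1..N} \<Longrightarrow> word_ratio r \<omega> powr b \<le> word_ratio r' \<omega>"
    using word_ratio_exponents by blast
  obtain A where A: "0 < A"
    and cyl: "\<And>w q. \<lbrakk>w \<in> infinite_words N; q \<in> K; q \<noteq> F.\<pi> w\<rbrakk> \<Longrightarrow> \<exists>n q'. separated_in_cylinder A w q n q'"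
    using snowflake_in_cylinder by blast
  obtain D where D: "0 < D" "\<And>p q. p \<in> K \<Longrightarrow> q \<in> K \<Longrightarrow> dist p q \<le> D"
    using F.diameter_bound by blast
  define C where "C = A * D powr (s - a)"
  have C: "0 < C"
    using A D(1) by (simp add: C_def)
  have hoelder: "dist (h p) (h q) \<le> C * dist p q powr a" if p: "p \<in> K" and q: "q \<in> K" for p q
  proof (cases "q = p")
    case True
    then show ?thesis by simp
  next
    case False
    obtain w where w: "w \<in> infinite_words N" "F.\<pi> w = p"
      using F.coding_map_surj[OF p] by blast
    have "q \<noteq> F.\<pi> w"
      using False w(2) by simp
    then obtain n q' where *: "q' \<in> K"
      "comparable s A (dist (F.\<pi> (\<lambda>k. w (n + k))) q') (dist (h (F.\<pi> (\<lambda>k. w (n + k)))) (h q'))"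
      "dist p q = word_ratio r (map w [0..<n]) * dist (F.\<pi> (\<lambda>k. w (n + k))) q'"
      "dist (h p) (h q) = word_ratio r' (map w [0..<n]) * dist (h (F.\<pi> (\<lambda>k. w (n + k)))) (h q')"
      using cyl[OF w(1) q] unfolding separated_in_cylinder_def w(2) by blast
    let ?R = "word_ratio r (map w [0..<n])" and ?d = "dist (F.\<pi> (\<lambda>k. w (n + k))) q'"
    have R: "0 < ?R"
      by (rule F.word_ratio_pos[OF map_upt_in_lists[OF w(1)]])
    have d: "0 \<le> ?d" "?d \<le> D"
      by (simp, rule D(2)[OF F.coding_map_in_K[OF infinite_words_shift[OF w(1)]] *(1)])
    have "?d powr s = ?d powr (s - a) * ?d powr a"
      by (simp flip: powr_add)
    also have "\<dots> \<le> D powr (s - a) * ?d powr a"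
      using d exps by (intro mult_right_mono powr_mono2) auto
    finally have ds: "A * ?d powr s \<le> C * ?d powr a"
      using A by (simp add: C_def)
    have "dist (h p) (h q) \<le> ?R powr a * (A * ?d powr s)"
      unfolding *(4) using *(2) upper[OF map_upt_in_lists[OF w(1)], of 0 n]
      by (intro mult_mono) (simp_all add: comparable_def)
    also have "\<dots> \<le> ?R powr a * (C * ?d powr a)"
      using ds by (intro mult_left_mono) simp_all
    also have "\<dots> = C * dist p q powr a"
      unfolding *(3) using R by (simp add: powr_mult)
    finally show ?thesis .
  qed
  show ?thesis
    unfolding continuous_on_iff
  proof (intro ballI allI impI)
    fix p and \<epsilon> :: real assume p: "p \<in> K" and \<epsilon>: "0 < \<epsilon>"
    have "dist (h q) (h p) < \<epsilon>" if q: "q \<in> K" "dist q p < (\<epsilon> / C) powr (1 / a)" for q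
    proof -
      have "dist q p powr a < ((\<epsilon> / C) powr (1 / a)) powr a"
        using q exps by (intro powr_less_mono2) auto
      also have "\<dots> = \<epsilon> / C"
        using exps \<epsilon> C by (simp add: powr_powr)
      finally have "C * dist q p powr a < \<epsilon>"
        using C by (simp add: field_simps)
      then show ?thesis
        using hoelder[OF q(1) p] by simp
    qed
    then show "\<exists>d>0. \<forall>q\<in>K. dist q p < d \<longrightarrow> dist (h q) (h p) < \<epsilon>"
      using \<epsilon> C by (intro exI[of _ "(\<epsilon> / C) powr (1 / a)"]) simp
  qed
qed

text \<open>Fix one coding of \<open>x\<close> and compare the levels \<open>n\<close> and
  \<open>m\<close> at which \<open>y\<close> and \<open>z\<close> leave it. The shared prefix
  cancels, and the stretch between the two levels is treated by \<open>cylinder_far\<close> or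
  \<open>cylinder_near\<close>.\<close>

lemma quasisymmetric_bound:
  obtains C a b where "0 < C" "0 < a" "0 < b"
    "\<And>x y z t. \<lbrakk>x \<in> K; y \<in> K; z \<in> K; 0 \<le> t; dist x y \<le> t * dist x z\<rbrakk> \<Longrightarrow>
      dist (h x) (h y) \<le> C * (t powr a + t powr b) * dist (h x) (h z)"
proof -
  obtain a b where exps: "0 < a" "a \<le> s" "s \<le> b"
    and upper: "\<And>\<omega>. \<omega> \<in> lists {1..N} \<Longrightarrow> word_ratio r' \<omega> \<le> word_ratio r \<omega> powr a"
    and lower: "\<And>\<omega>. \<omega> \<in> lists {1..N} \<Longrightarrow> word_ratio r \<omega> powr b \<le> word_ratio r' \<omega>"
    using word_ratio_exponents by blast
  obtain A where A: "0 < A"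
    and cyl: "\<And>w q. \<lbrakk>w \<in> infinite_words N; q \<in> K; q \<noteq> F.\<pi> w\<rbrakk> \<Longrightarrow> \<exists>n q'. separated_in_cylinder A w q n q'"
    using snowflake_in_cylinder by blast
  obtain D where D: "0 < D" "\<And>p q. p \<in> K \<Longrightarrow> q \<in> K \<Longrightarrow> dist p q \<le> D"
    using F.diameter_bound by blast
  obtain C1 where C1: "0 < C1"
    and far: "\<And>\<tau> p q e t. \<lbrakk>\<tau> \<in> lists {1..N}; p \<in> K; q \<in> K; \<tau> \<noteq> [] \<Longrightarrow> q \<notin> f (hd \<tau>) ` K; 0 \<le> e; e \<le> D;
      0 \<le> t; word_ratio r \<tau> * e \<le> t * dist (word_map f \<tau> p) q\<rbrakk> \<Longrightarrow>
      word_ratio r' \<tau> * e powr s \<le> C1 * (t powr a + t powr b) * dist (word_map f \<tau> p) q powr s"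
    using cylinder_far[OF exps upper D(1)] by blast
  obtain C2 where C2: "0 < C2"
    and near: "\<And>\<tau> p q e t. \<lbrakk>\<tau> \<in> lists {1..N}; p \<in> K; q \<in> K; \<tau> \<noteq> [] \<Longrightarrow> q \<notin> f (hd \<tau>) ` K; 0 \<le> e; e \<le> D;
      0 \<le> t; dist (word_map f \<tau> p) q \<le> t * (word_ratio r \<tau> * e)\<rbrakk> \<Longrightarrow>
      dist (word_map f \<tau> p) q powr s \<le> C2 * (t powr a + t powr b) * (word_ratio r' \<tau> * e powr s)"
    using cylinder_near[OF exps lower D(1)] by blast
  \<comment> \<open>\<open>A\<close> enters twice: in bounding the image distance to
    \<open>y\<close> by a snowflaked one, and in returning to the image distance to
    \<open>z\<close>.\<close>
  define C where "C = A * A * (C1 + C2)"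
  have C: "0 < C"
    using A C1 C2 by (simp add: C_def)
  have "dist (h x) (h y) \<le> C * (t powr a + t powr b) * dist (h x) (h z)"
    if xyz: "x \<in> K" "y \<in> K" "z \<in> K" and t: "0 \<le> t" and le: "dist x y \<le> t * dist x z" for x y z t
  proof (cases "y = x")
    case True
    then show ?thesis
      using C by simp
  next
    case False
    \<comment> \<open>With \<open>z = x\<close> the hypothesis would force
      \<open>y = x\<close>.\<close>
    then have "z \<noteq> x"
      using le by auto
    obtain w where w: "w \<in> infinite_words N" "F.\<pi> w = x"
      using F.coding_map_surj[OF xyz(1)] by blast
    define X where "X n = F.\<pi> (\<lambda>k. w (n + k))" for n
    define R where "R n = word_ratio r (map w [0..<n])" for n
    define R' where "R' n = word_ratio r' (map w [0..<n])" for n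
    define T where "T = t powr a + t powr b"
    have "y \<noteq> F.\<pi> w" "z \<noteq> F.\<pi> w"
      using w(2) False \<open>z \<noteq> x\<close> by simp_all
    obtain n y' where y: "y' \<in> K" "y' \<notin> f (w n) ` K" "comparable s A (dist (X n) y') (dist (h (X n)) (h y'))"
      "dist x y = R n * dist (X n) y'" "dist (h x) (h y) = R' n * dist (h (X n)) (h y')"
      using cyl[OF w(1) xyz(2) \<open>y \<noteq> F.\<pi> w\<close>] unfolding separated_in_cylinder_def w(2) X_def R_def R'_def by blast
    obtain m z' where z: "z' \<in> K" "z' \<notin> f (w m) ` K" "comparable s A (dist (X m) z') (dist (h (X m)) (h z'))"
      "dist x z = R m * dist (X m) z'" "dist (h x) (h z) = R' m * dist (h (X m)) (h z')"
      using cyl[OF w(1) xyz(3) \<open>z \<noteq> F.\<pi> w\<close>] unfolding separated_in_cylinder_def w(2) X_def R_def R'_def by blast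
    have X_in_K: "X k \<in> K" for k
      unfolding X_def by (rule F.coding_map_in_K[OF infinite_words_shift[OF w(1)]])
    have R_pos: "0 < R k" and R'_pos: "0 < R' k" for k
      unfolding R_def R'_def
      by (rule F.word_ratio_pos[OF map_upt_in_lists[OF w(1)]],
          rule G.word_ratio_pos[OF map_upt_in_lists[OF w(1)]])
    define \<tau> where "\<tau> k l = map (\<lambda>i. w (k + i)) [0..<l]" for k l
    have \<tau>: "\<tau> k l \<in> lists {1..N}" for k l
      unfolding \<tau>_def by (rule map_upt_in_lists[OF infinite_words_shift[OF w(1)]])
    \<comment> \<open>The stretch from level \<open>k\<close> begins with \<open>w k\<close>, whose
      piece is avoided by the point that leaves there: the side condition of \<open>far\<close> and
      \<open>near\<close>.\<close>
    have hd_\<tau>: "hd (\<tau> k l) = w k" if "\<tau> k l \<noteq> []" for k l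
      using that by (cases l) (simp_all add: \<tau>_def map_upt_Suc del: upt_Suc)
    have R_add: "R (k + l) = R k * word_ratio r (\<tau> k l)" "R' (k + l) = R' k * word_ratio r' (\<tau> k l)" for k l
      by (simp_all only: R_def R'_def \<tau>_def map_upt_add map_append prod_list.append)
    have X_add: "X k = word_map f (\<tau> k l) (X (k + l))" for k l
      using F.coding_map_shift[OF infinite_words_shift[OF w(1), of k], of l]
      by (simp only: X_def \<tau>_def add.assoc)
    have hy: "dist (h x) (h y) \<le> A * (R' n * dist (X n) y' powr s)"
      using mult_left_mono[of "dist (h (X n)) (h y')" "A * dist (X n) y' powr s" "R' n"] y(3) R'_pos[of n]
      unfolding y(5) by (simp add: comparable_def ac_simps)
    have hz: "R' m * dist (X m) z' powr s \<le> A * dist (h x) (h z)"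
      using mult_left_mono[of "dist (X m) z' powr s" "A * dist (h (X m)) (h z')" "R' m"] z(3) R'_pos[of m]
      unfolding z(5) by (simp add: comparable_def ac_simps)
    have T: "0 \<le> T"
      by (simp add: T_def)
    have main: "R' n * dist (X n) y' powr s \<le> (C1 + C2) * T * (R' m * dist (X m) z' powr s)"
    proof (cases "m \<le> n")
      case True
      then obtain l where l: "n = m + l"
        using le_Suc_ex by blast
      \<comment> \<open>\<open>z\<close> leaves first or at the same level; the factor
        \<open>R m\<close> of the shared prefix cancels.\<close>
      have "R m * (word_ratio r (\<tau> m l) * dist (X n) y') \<le> R m * (t * dist (X m) z')"
        using le unfolding y(4) z(4) l R_add by (simp add: ac_simps)
      then have "word_ratio r (\<tau> m l) * dist (X n) y' \<le> t * dist (X m) z'"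
        using R_pos by (simp only: mult_le_cancel_left_pos)
      then have "word_ratio r' (\<tau> m l) * dist (X n) y' powr s \<le> C1 * T * dist (X m) z' powr s"
        unfolding T_def X_add[of m l] l using hd_\<tau>[of m l] z(2)
        by (intro far \<tau> X_in_K z(1) t D(2) y(1) zero_le_dist) auto
      also have "\<dots> \<le> (C1 + C2) * T * dist (X m) z' powr s"
        using C2 T by (intro mult_right_mono) auto
      finally have "R' m * (word_ratio r' (\<tau> m l) * dist (X n) y' powr s) \<le>
          R' m * ((C1 + C2) * T * dist (X m) z' powr s)"
        using R'_pos[of m] by (intro mult_left_mono) auto
      then show ?thesis
        unfolding l R_add by (simp only: ac_simps)
    next
      case False
      then obtain l where l: "m = n + l"
        using le_Suc_ex[of n m] by auto
      \<comment> \<open>\<open>y\<close> leaves first, and \<open>R n\<close> cancels.\<close>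
      have "R n * dist (X n) y' \<le> R n * (t * (word_ratio r (\<tau> n l) * dist (X m) z'))"
        using le unfolding y(4) z(4) l R_add by (simp add: ac_simps)
      then have "dist (X n) y' \<le> t * (word_ratio r (\<tau> n l) * dist (X m) z')"
        using R_pos by (simp only: mult_le_cancel_left_pos)
      then have "dist (X n) y' powr s \<le> C2 * T * (word_ratio r' (\<tau> n l) * dist (X m) z' powr s)"
        unfolding T_def X_add[of n l] l using hd_\<tau>[of n l] y(2)
        by (intro near \<tau> X_in_K y(1) t D(2) z(1) zero_le_dist) auto
      also have "\<dots> \<le> (C1 + C2) * T * (word_ratio r' (\<tau> n l) * dist (X m) z' powr s)"
        using C1 T G.word_ratio_pos[OF \<tau>[of n l]] by (intro mult_right_mono) auto
      finally have "R' n * dist (X n) y' powr s \<le>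
          R' n * ((C1 + C2) * T * (word_ratio r' (\<tau> n l) * dist (X m) z' powr s))"
        using R'_pos[of n] by (intro mult_left_mono) auto
      then show ?thesis
        unfolding l R_add by (simp only: ac_simps)
    qed
    have "dist (h x) (h y) \<le> A * ((C1 + C2) * T * (A * dist (h x) (h z)))"
      using hy main hz A C1 C2 T
      by (meson add_nonneg_nonneg less_imp_le mult_left_mono mult_nonneg_nonneg order_trans)
    then show ?thesis
      by (simp add: C_def T_def ac_simps)
  qed
  then show thesis
    using that[of C a b] C exps by auto
qed

lemma quasisymmetrically_equivalent: "quasisymmetrically_equivalent K K'"
proof -
  obtain h' where h': "homeomorphism K K' h h'"
    using homeomorphism_compact[OF F.compact_K continuous_on_conjugacy] bij
    by (auto simp: bij_betw_def)
  obtain C a b where C: "0 < C" "0 < a" "0 < b"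
    and qs: "\<And>x y z t. \<lbrakk>x \<in> K; y \<in> K; z \<in> K; 0 \<le> t; dist x y \<le> t * dist x z\<rbrakk> \<Longrightarrow>
      dist (h x) (h y) \<le> C * (t powr a + t powr b) * dist (h x) (h z)"
    using quasisymmetric_bound by blast
  let ?\<eta> = "\<lambda>t. C * (t powr a + t powr b)"
  obtain \<eta>' where "homeomorphism {0..} {0..} ?\<eta> \<eta>'"
    using homeomorphism_powr_sum(2)[OF C] by blast
  with h' show ?thesis
    unfolding quasisymmetrically_equivalent_def using homeomorphism_powr_sum(1)[OF C] qs
    by (intro exI[of _ h] exI[of _ h'] exI[of _ ?\<eta>] exI[of _ \<eta>'] conjI ballI allI impI)
qed

end

section \<open>The two equivalences\<close>

theorem theorem1p2:
  fixes f :: "nat \<Rightarrow> 'a \<Rightarrow> 'a::complete_space"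
    and g :: "nat \<Rightarrow> 'b \<Rightarrow> 'b::complete_space"
    and N :: nat
    and K :: "'a set" and K' :: "'b set"
    and r r' :: "nat \<Rightarrow> real"
  assumes "ifs N f" and "ifs N g"
    and "is_attractor N f K" and "is_attractor N g K'"
    and "pcf N f K" and "pcf N g K'"
    and "SIC N f K" and "SIC N g K'"
    and "ASC N f K" and "ASC N g K'"
    and "same_topology_automaton N f K g K'"
    and "\<And>i. i \<in> {1..N} \<Longrightarrow> contractive_similitude (r i) (f i)"
    and "\<And>i. i \<in> {1..N} \<Longrightarrow> contractive_similitude (r' i) (g i)"
  shows "((\<forall>i\<in>{1..N}. r i = r' i) \<longrightarrow> lipschitz_equivalent K K') \<and>
         ((\<exists>s>0. \<forall>i\<in>boundary_letters N f K. r' i = r i powr s) \<longrightarrow>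
            quasisymmetrically_equivalent K K')"
proof (intro conjI impI)
  have F: "pcf_ifs N f K r" and G: "pcf_ifs N g K' r'"
    by unfold_locales (fact assms)+
  interpret F: pcf_ifs N f K r by (rule F)
  obtain h where h: "bij_betw h K K'" "\<And>i p. i \<in> {1..N} \<Longrightarrow> p \<in> K \<Longrightarrow> h (f i p) = g i (h p)"
    using same_topology_automaton_conjugacy[OF F G] assms by blast
  \<comment> \<open>One map \<open>h\<close> serves both claims; only the exponent \<open>s\<close>
    varies, with \<open>s = 1\<close> for the Lipschitz case.\<close>
  have conjugacy: "ifs_conjugacy N f K r g K' r' h s"
    if "0 < s" "\<And>i. i \<in> boundary_letters N f K \<Longrightarrow> r' i = r i powr s" for s
    by (intro ifs_conjugacy.intro ifs_conjugacy_axioms.intro F G h that)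
  {
    assume eq: "\<forall>i\<in>{1..N}. r i = r' i"
    have "r' i = r i powr 1" if "i \<in> boundary_letters N f K" for i
    proof -
      have i: "i \<in> {1..N}"
        using that infinite_words_nth unfolding boundary_letters_def post_critical_codings_def by blast
      then show ?thesis
        using eq F.ratio_pos[OF i] by simp
    qed
    then interpret ifs_conjugacy N f K r g K' r' h 1
      by (intro conjugacy) simp_all
    show "lipschitz_equivalent K K'"
      using eq by (intro lipschitz_equivalent_if_equal_ratios) simp_all
  }
  {
    assume "\<exists>s>0. \<forall>i\<in>boundary_letters N f K. r' i = r i powr s"
    then obtain s where "0 < s" "\<forall>i\<in>boundary_letters N f K. r' i = r i powr s"
      by blast
    then interpret ifs_conjugacy N f K r g K' r' h s
      by (intro conjugacy) simp_all
    show "quasisymmetrically_equivalent K K'"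
      by (rule quasisymmetrically_equivalent)
  }
qed

end
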